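(* Let $G$ be a finite group. Then $G$ is a flat group if and only if $G$ is a GVZ-group.
   Context: $\mathrm{Irr}(G)$ denotes the set of irreducible complex characters of $G$. For $\chi \in \mathrm{Irr}(G)$, the center of $\chi$ is $Z(\chi) = \{ g \in G \mid |\chi(g)| = \chi(1) \}$. A finite group $G$ is a GVZ-group if $\chi(1) = |G:Z(\chi)|^{1/2}$ for every $\chi \in \mathrm{Irr}(G)$. For $g \in G$, $\mathrm{cl}_G(g)$ denotes the conjugacy class of $g$ in $G$, and $[g,G]$ denotes the subgroup of $G$ generated by the set of commutators $\{ [g,x] \mid x \in G \}$, where $[g,x] = g^{-1}x^{-1}gx$. A finite group $G$ is flat if $|\mathrm{cl}_G(g)| = |[g,G]|$ for every $g \in G$ (equivalently, $\mathrm{cl}_G(g) = g[g,G]$ for every $g \in G$). *)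

theory Defs
  imports "Jordan_Normal_Form.VS_Connect" "HOL-Algebra.Generated_Groups"
begin

definition conj_class :: "('a, 'b) monoid_scheme \<Rightarrow> 'a \<Rightarrow> 'a set" where
  "conj_class G g = {inv\<^bsub>G\<^esub> x \<otimes>\<^bsub>G\<^esub> g \<otimes>\<^bsub>G\<^esub> x | x. x \<in> carrier G}"

definition commutator :: "('a, 'b) monoid_scheme \<Rightarrow> 'a \<Rightarrow> 'a \<Rightarrow> 'a" where
  "commutator G g x = inv\<^bsub>G\<^esub> g \<otimes>\<^bsub>G\<^esub> inv\<^bsub>G\<^esub> x \<otimes>\<^bsub>G\<^esub> g \<otimes>\<^bsub>G\<^esub> x"

definition commutator_subgroup :: "('a, 'b) monoid_scheme \<Rightarrow> 'a \<Rightarrow> 'a set" where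
  "commutator_subgroup G g = generate G {commutator G g x | x. x \<in> carrier G}"

definition flat_group :: "('a, 'b) monoid_scheme \<Rightarrow> bool" where
  "flat_group G \<longleftrightarrow>
     (\<forall>g\<in>carrier G. card (conj_class G g) = card (commutator_subgroup G g))"

definition GL :: "nat \<Rightarrow> complex mat monoid" where
  "GL n = units_of (ring_mat TYPE(complex) n ())"

definition representation ::
  "('a, 'b) monoid_scheme \<Rightarrow> nat \<Rightarrow> ('a \<Rightarrow> complex mat) \<Rightarrow> bool" where
  "representation G n \<rho> \<longleftrightarrow> \<rho> \<in> hom G (GL n)"

definition invariant_subspace ::
  "('a, 'b) monoid_scheme \<Rightarrow> nat \<Rightarrow> ('a \<Rightarrow> complex mat) \<Rightarrow> complex vec set \<Rightarrow> bool" where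
  "invariant_subspace G n \<rho> W \<longleftrightarrow>
     VectorSpace.subspace class_ring W (module_vec TYPE(complex) n) \<and>
     (\<forall>g\<in>carrier G. \<forall>w\<in>W. \<rho> g *\<^sub>v w \<in> W)"

definition irreducible_representation ::
  "('a, 'b) monoid_scheme \<Rightarrow> nat \<Rightarrow> ('a \<Rightarrow> complex mat) \<Rightarrow> bool" where
  "irreducible_representation G n \<rho> \<longleftrightarrow>
     representation G n \<rho> \<and> n > 0 \<and>
     (\<forall>W. invariant_subspace G n \<rho> W \<longrightarrow> W = {0\<^sub>v n} \<or> W = carrier_vec n)"

definition mat_trace :: "complex mat \<Rightarrow> complex" where
  "mat_trace A = (\<Sum>i<dim_row A. A $$ (i, i))"

text \<open>Characters are restricted to the carrier, so that two characters are equal as soon as they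
  agree on the group.\<close>

definition character_of ::
  "('a, 'b) monoid_scheme \<Rightarrow> ('a \<Rightarrow> complex mat) \<Rightarrow> 'a \<Rightarrow> complex" where
  "character_of G \<rho> = (\<lambda>g\<in>carrier G. mat_trace (\<rho> g))"

definition Irr :: "('a, 'b) monoid_scheme \<Rightarrow> ('a \<Rightarrow> complex) set" where
  "Irr G = {character_of G \<rho> | n \<rho>. irreducible_representation G n \<rho>}"

definition character_center ::
  "('a, 'b) monoid_scheme \<Rightarrow> ('a \<Rightarrow> complex) \<Rightarrow> 'a set" where
  "character_center G \<chi> = {g \<in> carrier G. complex_of_real (cmod (\<chi> g)) = \<chi> \<one>\<^bsub>G\<^esub>}"

definition GVZ_group :: "('a, 'b) monoid_scheme \<Rightarrow> bool" where
  "GVZ_group G \<longleftrightarrow>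
     (\<forall>\<chi>\<in>Irr G.
        \<chi> \<one>\<^bsub>G\<^esub> = complex_of_real (sqrt (real (card (rcosets\<^bsub>G\<^esub> (character_center G \<chi>))))))"

end

theory Submission
  imports Defs "Jordan_Normal_Form.Schur_Decomposition" "HOL-Algebra.Multiplicative_Group"
begin

text \<open>
  By Schur orthogonality, \<open>\<chi>(1)\<^sup>2 = |G:Z(\<chi>)|\<close> holds if and only if \<open>\<chi>\<close> vanishes off \<open>Z(\<chi>)\<close>,
  and \<open>g \<in> Z(\<chi>)\<close> if and only if \<open>[g,G]\<close> lies in the kernel of \<open>\<chi>\<close>.  The coset \<open>g[g,G]\<close> is invariant
  under conjugation and under right multiplication by \<open>[g,G]\<close>, so the sum of \<open>\<chi>\<close> over it vanishes
  unless \<open>g \<in> Z(\<chi>)\<close>.  If \<open>G\<close> is flat, this coset is the class of \<open>g\<close>, hence \<open>\<chi>(g) = 0\<close> for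
  \<open>g \<notin> Z(\<chi>)\<close>.  Conversely, if every \<open>\<chi>\<close> vanishes off \<open>Z(\<chi>)\<close>, the normalised indicators of the
  class of \<open>g\<close> and of \<open>g[g,G]\<close> have the same sum against every irreducible character, so they
  coincide, because a nonzero class function acts as a nonzero operator in some irreducible
  constituent of the regular representation.
\<close>

subsection \<open>Traces and sums of matrices\<close>

text \<open>The converse rests on completeness: a class function whose operator vanishes in every
  irreducible representation is zero. Convolution by \<open>f\<close> may have trace zero although
  \<open>f\<close> is nonzero, so its trace alone does not reveal a nonzero eigenvalue. Composing it
  with its adjoint gives trace |G| times the sum of |f(x)|^2, which is positive, and hence a nonzero
  eigenvalue. The eigenspace is invariant because class functions are central in the group algebra,
  and a minimal nonzero invariant subspace of it is an irreducible representation in which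
  \<open>f\<close> cannot act as zero. The other obstacle is to read Z(\<chi>) off from absolute
  values of traces. A matrix of finite order is brought to triangular form; its diagonal entries are
  roots of unity, so a trace of maximal modulus makes them all equal, and finite order then kills
  the part above the diagonal. Thus Z(\<chi>) becomes the set of elements acting by scalars, and by
  Schur's lemma these are the elements whose image commutes with the whole representation. This is
  the link between Z(\<chi>) and [g,G].\<close>

lemma mat_mult_index_sum:
  assumes "A \<in> carrier_mat n m" "B \<in> carrier_mat m k" "i < n" "j < k"
  shows "(A * B) $$ (i, j) = (\<Sum>l<m. A $$ (i, l) * B $$ (l, j))"
  using assms by (simp add: scalar_prod_def atLeast0LessThan)

lemma mat_mult_vec_index_sum:
  assumes "A \<in> carrier_mat n m" "v \<in> carrier_vec m" "i < n"
  shows "(A *\<^sub>v v) $ i = (\<Sum>l<m. A $$ (i, l) * v $ l)"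
  using assms by (simp add: scalar_prod_def atLeast0LessThan)

lemma mat_trace_carrier: "A \<in> carrier_mat n n \<Longrightarrow> mat_trace A = (\<Sum>i<n. A $$ (i, i))"
  by (simp add: mat_trace_def)

lemma mat_trace_mult_commute:
  assumes "A \<in> carrier_mat n m" "B \<in> carrier_mat m n"
  shows "mat_trace (A * B) = mat_trace (B * A)"
proof -
  have "mat_trace (A * B) = (\<Sum>i<n. \<Sum>l<m. A $$ (i, l) * B $$ (l, i))"
    using assms by (simp add: mat_trace_carrier[of _ n] mat_mult_index_sum[OF assms] del: index_mult_mat)
  also have "\<dots> = (\<Sum>l<m. \<Sum>i<n. A $$ (i, l) * B $$ (l, i))"
    by (rule sum.swap)
  also have "\<dots> = mat_trace (B * A)"
    using assms by (simp add: mat_trace_carrier[of _ m] mat_mult_index_sum[OF assms(2,1)] mult.commute del: index_mult_mat)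
  finally show ?thesis .
qed

lemma mat_trace_one: "mat_trace (1\<^sub>m n) = of_nat n"
  by (simp add: mat_trace_def)

lemma mat_trace_smult_one: "mat_trace (c \<cdot>\<^sub>m 1\<^sub>m n) = of_nat n * c"
  by (simp add: mat_trace_def)

lemma mat_trace_smult: "A \<in> carrier_mat n n \<Longrightarrow> mat_trace (c \<cdot>\<^sub>m A) = c * mat_trace A"
  by (simp add: mat_trace_def sum_distrib_left)

lemma scalar_mat_eq_zero:
  assumes "mat_trace (c \<cdot>\<^sub>m 1\<^sub>m n) = 0"
  shows "c \<cdot>\<^sub>m 1\<^sub>m n = 0\<^sub>m n n"
proof -
  have "n = 0 \<or> c = 0" using assms by (simp add: mat_trace_smult_one)
  then show ?thesis by (intro eq_matI) auto
qed

text \<open>Matrices of all sizes share one type, so an empty sum has no size of its own; passing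
  the dimensions explicitly fixes it.\<close>

definition mat_sum :: "nat \<Rightarrow> nat \<Rightarrow> 'i set \<Rightarrow> ('i \<Rightarrow> complex mat) \<Rightarrow> complex mat" where
  "mat_sum n m X F = mat n m (\<lambda>(i, j). \<Sum>x\<in>X. F x $$ (i, j))"

lemma mat_sum_carrier [simp]: "mat_sum n m X F \<in> carrier_mat n m"
  by (simp add: mat_sum_def)

lemma mat_sum_index: "i < n \<Longrightarrow> j < m \<Longrightarrow> mat_sum n m X F $$ (i, j) = (\<Sum>x\<in>X. F x $$ (i, j))"
  by (simp add: mat_sum_def)

lemma mat_sum_cong: "(\<And>x. x \<in> X \<Longrightarrow> F x = H x) \<Longrightarrow> mat_sum n m X F = mat_sum n m X H"
  by (simp add: mat_sum_def)

lemma mat_sum_reindex_bij_betw: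
  "bij_betw h X Y \<Longrightarrow> mat_sum n m X (\<lambda>x. F (h x)) = mat_sum n m Y F"
  unfolding mat_sum_def by (subst sum.reindex_bij_betw) auto

lemma mat_mult_mat_sum:
  assumes A: "A \<in> carrier_mat k n" and F: "\<And>x. x \<in> X \<Longrightarrow> F x \<in> carrier_mat n m"
  shows "A * mat_sum n m X F = mat_sum k m X (\<lambda>x. A * F x)"
proof (rule eq_matI)
  fix i j assume "i < dim_row (mat_sum k m X (\<lambda>x. A * F x))" "j < dim_col (mat_sum k m X (\<lambda>x. A * F x))"
  then have ij: "i < k" "j < m" by (simp_all add: mat_sum_def)
  have "(A * mat_sum n m X F) $$ (i, j) = (\<Sum>l<n. A $$ (i, l) * (\<Sum>x\<in>X. F x $$ (l, j)))"
    using ij by (simp add: mat_mult_index_sum[OF A mat_sum_carrier] mat_sum_index)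
  also have "\<dots> = (\<Sum>x\<in>X. \<Sum>l<n. A $$ (i, l) * F x $$ (l, j))"
    by (simp add: sum_distrib_left) (rule sum.swap)
  also have "\<dots> = (\<Sum>x\<in>X. (A * F x) $$ (i, j))"
    by (rule sum.cong) (simp_all add: mat_mult_index_sum[OF A F] ij)
  finally show "(A * mat_sum n m X F) $$ (i, j) = mat_sum k m X (\<lambda>x. A * F x) $$ (i, j)"
    using ij by (simp add: mat_sum_index)
qed (use A in \<open>auto simp: mat_sum_def\<close>)

lemma mat_sum_mult_mat:
  assumes A: "A \<in> carrier_mat m k" and F: "\<And>x. x \<in> X \<Longrightarrow> F x \<in> carrier_mat n m"
  shows "mat_sum n m X F * A = mat_sum n k X (\<lambda>x. F x * A)"
proof (rule eq_matI)
  fix i j assume "i < dim_row (mat_sum n k X (\<lambda>x. F x * A))" "j < dim_col (mat_sum n k X (\<lambda>x. F x * A))"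
  then have ij: "i < n" "j < k" by (simp_all add: mat_sum_def)
  have "(mat_sum n m X F * A) $$ (i, j) = (\<Sum>l<m. (\<Sum>x\<in>X. F x $$ (i, l)) * A $$ (l, j))"
    using ij by (simp add: mat_mult_index_sum[OF mat_sum_carrier A] mat_sum_index)
  also have "\<dots> = (\<Sum>x\<in>X. \<Sum>l<m. F x $$ (i, l) * A $$ (l, j))"
    by (simp add: sum_distrib_right) (rule sum.swap)
  also have "\<dots> = (\<Sum>x\<in>X. (F x * A) $$ (i, j))"
    by (rule sum.cong) (simp_all add: mat_mult_index_sum[OF F A] ij)
  finally show "(mat_sum n m X F * A) $$ (i, j) = mat_sum n k X (\<lambda>x. F x * A) $$ (i, j)"
    using ij by (simp add: mat_sum_index)
qed (use A in \<open>auto simp: mat_sum_def\<close>)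

lemma mat_trace_mat_sum:
  assumes "\<And>x. x \<in> X \<Longrightarrow> F x \<in> carrier_mat n n"
  shows "mat_trace (mat_sum n n X F) = (\<Sum>x\<in>X. mat_trace (F x))"
proof -
  have "mat_trace (mat_sum n n X F) = (\<Sum>i<n. \<Sum>x\<in>X. F x $$ (i, i))"
    by (simp add: mat_trace_carrier[OF mat_sum_carrier] mat_sum_index)
  also have "\<dots> = (\<Sum>x\<in>X. \<Sum>i<n. F x $$ (i, i))"
    by (rule sum.swap)
  also have "\<dots> = (\<Sum>x\<in>X. mat_trace (F x))"
    by (rule sum.cong) (simp_all add: mat_trace_carrier[OF assms])
  finally show ?thesis .
qed

subsection \<open>Injective matrices and subspaces\<close>

text \<open>Trivial kernel means linearly independent columns, so such a matrix is a basis of its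
  image. Subspaces are handled below as images of these matrices, with the number of columns as
  dimension.\<close>

definition injective_mat :: "'a :: field mat \<Rightarrow> bool" where
  "injective_mat P \<longleftrightarrow>
    (\<forall>v\<in>carrier_vec (dim_col P). P *\<^sub>v v = 0\<^sub>v (dim_row P) \<longrightarrow> v = 0\<^sub>v (dim_col P))"

lemma injective_matI:
  assumes "P \<in> carrier_mat n m"
    and "\<And>v. v \<in> carrier_vec m \<Longrightarrow> P *\<^sub>v v = 0\<^sub>v n \<Longrightarrow> v = 0\<^sub>v m"
  shows "injective_mat P"
  using assms unfolding injective_mat_def by auto

lemma injective_matD:
  assumes "injective_mat P" "P \<in> carrier_mat n m" "v \<in> carrier_vec m" "P *\<^sub>v v = 0\<^sub>v n"
  shows "v = 0\<^sub>v m"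
  using assms unfolding injective_mat_def by auto

lemma injective_mat_mult:
  assumes P: "injective_mat P" "P \<in> carrier_mat n m" and S: "injective_mat S" "S \<in> carrier_mat m k"
  shows "injective_mat (P * S)"
proof (rule injective_matI)
  fix v :: "'a vec" assume v: "v \<in> carrier_vec k" and "P * S *\<^sub>v v = 0\<^sub>v n"
  then have "P *\<^sub>v (S *\<^sub>v v) = 0\<^sub>v n" using P S by simp
  moreover have "S *\<^sub>v v \<in> carrier_vec m" using S v by simp
  ultimately have "S *\<^sub>v v = 0\<^sub>v m" using injective_matD[OF P] by blast
  then show "v = 0\<^sub>v k" by (rule injective_matD[OF S v])
qed (use P S in simp)

lemma injective_mat_cancel:
  assumes P: "injective_mat P" "P \<in> carrier_mat n m"
    and "R \<in> carrier_mat m k" "R' \<in> carrier_mat m k" and eq: "P * R = P * R'"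
  shows "R = R'"
proof (rule mat_col_eqI)
  fix j assume "j < dim_col R'"
  then have j: "j < k" using assms by simp
  have [simp]: "col R j \<in> carrier_vec m" "col R' j \<in> carrier_vec m"
    using assms by auto
  have "P *\<^sub>v col R j = P *\<^sub>v col R' j"
    using eq assms j by (metis col_mult2)
  then have "P *\<^sub>v (col R j - col R' j) = 0\<^sub>v n"
    using P by (simp add: mult_minus_distrib_mat_vec[of _ n m])
  then have "col R j - col R' j = 0\<^sub>v m"
    by (intro injective_matD[OF P]) auto
  then have "(col R j - col R' j) $ i = 0" if "i < m" for i using that by simp
  then show "col R j = col R' j"
    using assms by (intro eq_vecI) auto
qed (use assms in auto)

lemma subspace_iff:
  "VectorSpace.subspace class_ring W (module_vec TYPE('a :: field) n) \<longleftrightarrow>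
    W \<subseteq> carrier_vec n \<and> 0\<^sub>v n \<in> W \<and> (\<forall>v\<in>W. \<forall>w\<in>W. v + w \<in> W) \<and> (\<forall>c. \<forall>v\<in>W. c \<cdot>\<^sub>v v \<in> W)"
  unfolding VectorSpace.subspace_def submodule_def
  using vec_vs[where 'a = 'a and n = n] vec_module[where 'a = 'a and n = n]
  by (auto simp: module_vec_simps class_ring_simps)

text \<open>With more columns than rows, padding by zero rows gives a singular square matrix, and a
  nonzero kernel vector of it is also killed by \<open>P\<close>.\<close>

lemma injective_mat_dim_le:
  assumes P: "injective_mat P" "P \<in> carrier_mat n m"
  shows "m \<le> n"
proof (rule ccontr)
  assume "\<not> m \<le> n"
  then have nm: "n < m" by simp
  define M where "M = mat m m (\<lambda>(i, j). if i < n then P $$ (i, j) else 0)"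
  have M: "M \<in> carrier_mat m m" by (simp add: M_def)
  \<comment> \<open>Row \<open>n\<close> of \<open>M\<close> is zero; passing to the transpose turns
    this row into a kernel vector, as the determinant criterion requires.\<close>
  have "transpose_mat M *\<^sub>v unit_vec m n = 0\<^sub>v m"
    using nm by (intro eq_vecI) (auto simp: M_def)
  moreover have "unit_vec m n \<noteq> (0\<^sub>v m :: 'a vec)" "unit_vec m n \<in> (carrier_vec m :: 'a vec set)"
    using nm by auto
  moreover have "transpose_mat M \<in> carrier_mat m m" using M by simp
  ultimately have "det (transpose_mat M) = 0"
    using det_0_iff_vec_prod_zero by blast
  then have "det M = 0" using det_transpose[OF M] by simp
  then obtain v where v: "v \<in> carrier_vec m" "v \<noteq> 0\<^sub>v m" "M *\<^sub>v v = 0\<^sub>v m"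
    using det_0_iff_vec_prod_zero[OF M] by auto
  have "P *\<^sub>v v = 0\<^sub>v n"
  proof (rule eq_vecI)
    fix i assume "i < dim_vec (0\<^sub>v n)"
    then have i: "i < n" by simp
    then have "(P *\<^sub>v v) $ i = (M *\<^sub>v v) $ i"
      using nm by (simp add: mat_mult_vec_index_sum[OF P(2) v(1)] mat_mult_vec_index_sum[OF M v(1)]
          del: index_mult_mat_vec) (simp add: M_def)
    also have "\<dots> = 0\<^sub>v n $ i" using v(3) i nm by simp
    finally show "(P *\<^sub>v v) $ i = 0\<^sub>v n $ i" .
  qed (use P in simp)
  then show False using injective_matD[OF P v(1)] v(2) by simp
qed

text \<open>The vector \<open>w\<close> is appended as a last column. A kernel vector with nonzero
  last coordinate would express \<open>w\<close> through the columns of \<open>P\<close>, against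
  the choice of \<open>w\<close>.\<close>

lemma injective_mat_extend:
  assumes P: "injective_mat P" "P \<in> carrier_mat n m"
    and W: "VectorSpace.subspace class_ring W (module_vec TYPE('a :: field) n)"
    and PW: "\<And>v. v \<in> carrier_vec m \<Longrightarrow> P *\<^sub>v v \<in> W"
    and w: "w \<in> W" "w \<notin> (\<lambda>v. P *\<^sub>v v) ` carrier_vec m"
  shows "\<exists>P' :: 'a mat. injective_mat P' \<and> P' \<in> carrier_mat n (Suc m) \<and>
    (\<forall>v\<in>carrier_vec (Suc m). P' *\<^sub>v v \<in> W)"
proof -
  note W = W[unfolded subspace_iff]
  have wn: "w \<in> carrier_vec n" using W w by auto
  define P' where "P' = mat n (Suc m) (\<lambda>(i, j). if j < m then P $$ (i, j) else w $ i)"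
  have P': "P' \<in> carrier_mat n (Suc m)" by (simp add: P'_def)
  \<comment> \<open>Drops the last coordinate, which is the coefficient of \<open>w\<close>.\<close>
  define tr where "tr v = vec m (\<lambda>i. v $ i)" for v :: "'a vec"
  have tr: "tr v \<in> carrier_vec m" for v by (simp add: tr_def)
  have P'v: "P' *\<^sub>v v = P *\<^sub>v tr v + v $ m \<cdot>\<^sub>v w" if v: "v \<in> carrier_vec (Suc m)" for v
  proof (rule eq_vecI)
    fix i assume "i < dim_vec (P *\<^sub>v tr v + v $ m \<cdot>\<^sub>v w)"
    then have i: "i < n" using wn P by simp
    have "(P' *\<^sub>v v) $ i = (\<Sum>l<m. P $$ (i, l) * v $ l) + w $ i * v $ m"
      unfolding mat_mult_vec_index_sum[OF P' v i] using i by (simp add: P'_def)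
    moreover have "(P *\<^sub>v tr v) $ i = (\<Sum>l<m. P $$ (i, l) * v $ l)"
      unfolding mat_mult_vec_index_sum[OF P(2) tr i] by (simp add: tr_def)
    ultimately show "(P' *\<^sub>v v) $ i = (P *\<^sub>v tr v + v $ m \<cdot>\<^sub>v w) $ i"
      using i P wn by (simp add: mult.commute del: index_mult_mat_vec)
  qed (use P P' wn in auto)
  have "injective_mat P'"
  proof (rule injective_matI[OF P'])
    fix v assume v: "v \<in> carrier_vec (Suc m)" and 0: "P' *\<^sub>v v = 0\<^sub>v n"
    have eq: "P *\<^sub>v tr v + v $ m \<cdot>\<^sub>v w = 0\<^sub>v n" using P'v[OF v] 0 by simp
    have vm: "v $ m = 0"
    proof (rule ccontr)
      assume c: "v $ m \<noteq> 0"
      have "w = P *\<^sub>v ((- 1 / v $ m) \<cdot>\<^sub>v tr v)"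
      proof (rule eq_vecI)
        fix i assume "i < dim_vec (P *\<^sub>v ((- 1 / v $ m) \<cdot>\<^sub>v tr v))"
        then have i: "i < n" using P by simp
        have "(P *\<^sub>v tr v + v $ m \<cdot>\<^sub>v w) $ i = 0" using eq i by simp
        then have *: "(P *\<^sub>v tr v) $ i + v $ m * w $ i = 0" using i P wn by simp
        then have "w $ i = (- 1 / v $ m) * (P *\<^sub>v tr v) $ i"
          using c by (simp add: field_simps eq_neg_iff_add_eq_0)
        moreover have "P *\<^sub>v ((- 1 / v $ m) \<cdot>\<^sub>v tr v) = (- 1 / v $ m) \<cdot>\<^sub>v (P *\<^sub>v tr v)"
          by (rule mult_mat_vec[OF P(2) tr])
        ultimately show "w $ i = (P *\<^sub>v ((- 1 / v $ m) \<cdot>\<^sub>v tr v)) $ i" using i P by simp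
      qed (use wn P in auto)
      moreover have "(- 1 / v $ m) \<cdot>\<^sub>v tr v \<in> carrier_vec m" using tr by simp
      ultimately show False using w(2) by blast
    qed
    have "P *\<^sub>v tr v = 0\<^sub>v n"
    proof (rule eq_vecI)
      fix i assume "i < dim_vec (0\<^sub>v n)"
      then have i: "i < n" by simp
      have "(P *\<^sub>v tr v + v $ m \<cdot>\<^sub>v w) $ i = 0" using eq i by simp
      then show "(P *\<^sub>v tr v) $ i = 0\<^sub>v n $ i" using i P wn vm by simp
    qed (use P in simp)
    then have "tr v = 0\<^sub>v m" by (rule injective_matD[OF P tr])
    then have "v $ i = 0" if "i < m" for i
      using that by (metis index_vec index_zero_vec(1) tr_def)
    then show "v = 0\<^sub>v (Suc m)"
      using v vm by (intro eq_vecI) (auto simp: less_Suc_eq)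
  qed
  moreover have "P' *\<^sub>v v \<in> W" if v: "v \<in> carrier_vec (Suc m)" for v
    unfolding P'v[OF v] using W PW[OF tr] w(1) by blast
  ultimately show ?thesis using P' by blast
qed

text \<open>Existence of a basis by maximality: among injective matrices with image inside
  \<open>W\<close> one with the most columns exists, since their number is at most \<open>n\<close>,
  and a vector of \<open>W\<close> outside its image could be appended.\<close>

lemma subspace_eq_image_injective_mat:
  fixes W :: "'a :: field vec set"
  assumes W: "VectorSpace.subspace class_ring W (module_vec TYPE('a) n)"
  obtains m and P :: "'a mat" where "injective_mat P" "P \<in> carrier_mat n m"
    "W = (\<lambda>v. P *\<^sub>v v) ` carrier_vec m"
proof -
  define Q where "Q m \<longleftrightarrow> (\<exists>P :: 'a mat. injective_mat P \<and> P \<in> carrier_mat n m \<and>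
    (\<forall>v\<in>carrier_vec m. P *\<^sub>v v \<in> W))" for m
  have "Q 0"
  proof -
    have "0\<^sub>m n 0 *\<^sub>v v = 0\<^sub>v n" if "v \<in> carrier_vec 0" for v :: "'a vec"
      using that by (intro eq_vecI) (auto simp: scalar_prod_def)
    moreover have "injective_mat (0\<^sub>m n 0 :: 'a mat)"
      by (rule injective_matI[of _ n 0]) auto
    ultimately show ?thesis unfolding Q_def using W[unfolded subspace_iff]
      by (intro exI[of _ "0\<^sub>m n 0"]) auto
  qed
  have bound: "\<forall>m. Q m \<longrightarrow> m \<le> n" unfolding Q_def using injective_mat_dim_le by blast
  define m where "m = Greatest Q"
  have "Q m" unfolding m_def using \<open>Q 0\<close> bound by (intro GreatestI_nat[of Q 0 n]) auto
  then obtain P where P: "injective_mat P" "P \<in> carrier_mat n m" "\<forall>v\<in>carrier_vec m. P *\<^sub>v v \<in> W"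
    unfolding Q_def by auto
  have "W \<subseteq> (\<lambda>v. P *\<^sub>v v) ` carrier_vec m"
  proof (rule ccontr)
    assume "\<not> ?thesis"
    then obtain w where w: "w \<in> W" "w \<notin> (\<lambda>v. P *\<^sub>v v) ` carrier_vec m" by blast
    have "Q (Suc m)" unfolding Q_def
      by (rule injective_mat_extend[OF P(1,2) W _ w]) (use P in auto)
    then have "Suc m \<le> m" unfolding m_def using bound by (intro Greatest_le_nat[where b = n]) auto
    then show False by simp
  qed
  then show ?thesis using that[OF P(1,2)] P(3) by auto
qed

text \<open>A vector missed by \<open>P\<close> could be appended as a column, giving more
  independent columns than rows.\<close>

lemma injective_mat_square_surj:
  fixes P :: "'a :: field mat"
  assumes P: "injective_mat P" "P \<in> carrier_mat n n"
  shows "(\<lambda>v. P *\<^sub>v v) ` carrier_vec n = carrier_vec n"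
proof (rule ccontr)
  assume neq: "\<not> ?thesis"
  have "(\<lambda>v. P *\<^sub>v v) ` carrier_vec n \<subseteq> carrier_vec n" using P by auto
  then obtain w where "w \<in> carrier_vec n" "w \<notin> (\<lambda>v. P *\<^sub>v v) ` carrier_vec n"
    using neq by blast
  moreover have "VectorSpace.subspace class_ring (carrier_vec n) (module_vec TYPE('a) n)"
    by (simp add: subspace_iff)
  ultimately obtain P' :: "'a mat" where "injective_mat P'" "P' \<in> carrier_mat n (Suc n)"
    using injective_mat_extend[OF P] P by (metis mult_mat_vec_carrier)
  then show False using injective_mat_dim_le by fastforce
qed

subsection \<open>Complex matrices of finite order\<close>

lemma complex_mat_similar_upper_triangular:
  fixes A :: "complex mat"
  assumes A: "A \<in> carrier_mat n n"
  obtains B P Q where "similar_mat_wit A B P Q" "upper_triangular B" "B \<in> carrier_mat n n"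
proof -
  obtain as where "char_poly A = (\<Prod>a\<leftarrow>as. [:- a, 1:])"
    using char_poly_factorized[OF A] by blast
  from schur_decomposition_exists[OF A this] show ?thesis
    using that unfolding similar_mat_def by blast
qed

lemma upper_triangular_mult_diag:
  fixes A :: "'a :: comm_semiring_1 mat"
  assumes A: "A \<in> carrier_mat n n" "upper_triangular A"
    and B: "B \<in> carrier_mat n n" "upper_triangular B" and i: "i < n"
  shows "(A * B) $$ (i, i) = A $$ (i, i) * B $$ (i, i)"
proof -
  have "(A * B) $$ (i, i) = (\<Sum>l\<in>{..<n}. A $$ (i, l) * B $$ (l, i))"
    using A B i by (simp add: mat_mult_index_sum[of _ n n] del: index_mult_mat)
  also have "\<dots> = (\<Sum>l\<in>{i}. A $$ (i, l) * B $$ (l, i))"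
  proof (rule sum.mono_neutral_right)
    show "\<forall>l\<in>{..<n} - {i}. A $$ (i, l) * B $$ (l, i) = 0"
    proof
      fix l assume l: "l \<in> {..<n} - {i}"
      then consider "l < i" | "i < l" by force
      then show "A $$ (i, l) * B $$ (l, i) = 0"
        using upper_triangularD[OF A(2), of l i] upper_triangularD[OF B(2), of i l] A B i l
        by cases auto
    qed
  qed (use i in auto)
  finally show ?thesis by simp
qed

lemma upper_triangular_mult:
  fixes A :: "'a :: comm_semiring_1 mat"
  assumes A: "A \<in> carrier_mat n n" "upper_triangular A"
    and B: "B \<in> carrier_mat n n" "upper_triangular B"
  shows "upper_triangular (A * B)"
proof (rule upper_triangularI)
  fix i j assume ji: "j < i" and "i < dim_row (A * B)"
  then have i: "i < n" using A by simp
  have "(A * B) $$ (i, j) = (\<Sum>l\<in>{..<n}. A $$ (i, l) * B $$ (l, j))"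
    using A B i ji by (simp add: mat_mult_index_sum[of _ n n] del: index_mult_mat)
  also have "\<dots> = 0"
  proof (rule sum.neutral, rule)
    fix l assume l: "l \<in> {..<n}"
    consider "l < i" | "j < l" using ji by linarith
    then show "A $$ (i, l) * B $$ (l, j) = 0"
      using upper_triangularD[OF A(2), of l i] upper_triangularD[OF B(2), of j l] A B i l
      by cases auto
  qed
  finally show "(A * B) $$ (i, j) = 0" .
qed

lemma upper_triangular_pow:
  fixes B :: "'a :: comm_semiring_1 mat"
  assumes B: "B \<in> carrier_mat n n" "upper_triangular B"
  shows "upper_triangular (B ^\<^sub>m k)" and "i < n \<Longrightarrow> (B ^\<^sub>m k) $$ (i, i) = (B $$ (i, i)) ^ k"
proof -
  have *: "upper_triangular (B ^\<^sub>m k) \<and> (\<forall>i<n. (B ^\<^sub>m k) $$ (i, i) = (B $$ (i, i)) ^ k)"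
  proof (induction k)
    case 0
    then show ?case using B by simp
  next
    case (Suc k)
    have "B ^\<^sub>m k \<in> carrier_mat n n" using B by (simp add: pow_carrier_mat)
    then show ?case
      using Suc B upper_triangular_mult[of "B ^\<^sub>m k" n B]
      by (simp add: upper_triangular_mult_diag[of "B ^\<^sub>m k" n B] mult.commute del: index_mult_mat)
  qed
  then show "upper_triangular (B ^\<^sub>m k)" "i < n \<Longrightarrow> (B ^\<^sub>m k) $$ (i, i) = (B $$ (i, i)) ^ k"
    by auto
qed

lemma mat_trace_similar:
  assumes A: "A \<in> carrier_mat n n" and sim: "similar_mat_wit A B P Q"
  shows "mat_trace A = mat_trace B"
proof -
  note s = similar_mat_witD2[OF A sim]
  have "mat_trace A = mat_trace (Q * (P * B))"
    unfolding s(3) using s by (intro mat_trace_mult_commute[of _ n n]) auto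
  also have "Q * (P * B) = B"
    using s by (simp flip: assoc_mult_mat[of Q n n P n B n])
  finally show ?thesis .
qed

text \<open>In characteristic zero a nontrivial unipotent part has infinite order. Concretely, once
  the columns left of \<open>j\<close> are known to be diagonal, the entry (i, j) of the k-th power
  is k c^(k-1) times that of \<open>B\<close>, and it must vanish for k = m.\<close>

lemma upper_triangular_finite_order_scalar:
  fixes B :: "complex mat"
  assumes B: "B \<in> carrier_mat n n" "upper_triangular B"
    and diag: "\<And>i. i < n \<Longrightarrow> B $$ (i, i) = c"
    and m: "m > 0" "B ^\<^sub>m m = 1\<^sub>m n"
  shows "B = c \<cdot>\<^sub>m 1\<^sub>m n"
proof -
  have "B $$ (i, j) = 0" if "j < n" "i < j" for i j
    using that
  proof (induction j arbitrary: i rule: less_induct)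
    case (less j)
    have col: "B $$ (r, l) = (if r = l then c else 0)" if "l < j" "r < n" for r l
      using less.IH[of l r] less.prems that diag[of r] upper_triangularD[OF B(2), of l r] B(1)
      by (cases r l rule: linorder_cases) auto
    have step: "(B ^\<^sub>m Suc k) $$ (r, l) = (\<Sum>q\<in>{..<n}. (B ^\<^sub>m k) $$ (r, q) * B $$ (q, l))"
      if "r < n" "l < n" for k r l
      using that B(1) by (simp add: mat_mult_index_sum[of _ n n] pow_carrier_mat del: index_mult_mat)
    \<comment> \<open>By the induction hypothesis the columns left of \<open>j\<close> are those of
      a scalar matrix, and this persists in all powers.\<close>
    have low: "(B ^\<^sub>m k) $$ (r, l) = (if r = l then c ^ k else 0)" if l: "l < j" and r: "r < n" for k r l
    proof (induction k)
      case 0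
      then show ?case using l r less.prems B(1) by simp
    next
      case (Suc k)
      have "(B ^\<^sub>m Suc k) $$ (r, l) = (\<Sum>q\<in>{..<n}. (B ^\<^sub>m k) $$ (r, q) * (if q = l then c else 0))"
        using l r less.prems by (subst step) (auto intro!: sum.cong simp: col)
      also have "\<dots> = (B ^\<^sub>m k) $$ (r, l) * c"
        using l less.prems by (subst sum.cong[OF refl, of _ _ "\<lambda>q. if q = l then (B ^\<^sub>m k) $$ (r, l) * c else 0"]) auto
      finally show ?case using Suc by simp
    qed
    have i: "i < n" using less.prems by simp
    \<comment> \<open>The extra factor \<open>c\<close> avoids the exponent k - 1, which would be
      truncated at k = 0.\<close>
    have *: "c * (B ^\<^sub>m k) $$ (i, j) = of_nat k * c ^ k * B $$ (i, j)" for k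
    proof (induction k)
      case 0
      then show ?case using less.prems B(1) by simp
    next
      case (Suc k)
      have "(B ^\<^sub>m Suc k) $$ (i, j) = (\<Sum>q\<in>{..<n}. (B ^\<^sub>m k) $$ (i, q) * B $$ (q, j))"
        using i less.prems by (intro step) auto
      \<comment> \<open>To the left of \<open>j\<close> only q = i survives by \<open>low\<close>;
        to the right of \<open>j\<close> the factor from \<open>B\<close> vanishes by
        triangularity.\<close>
      also have "\<dots> = (\<Sum>q\<in>{i, j}. (B ^\<^sub>m k) $$ (i, q) * B $$ (q, j))"
      proof (rule sum.mono_neutral_right)
        show "\<forall>q\<in>{..<n} - {i, j}. (B ^\<^sub>m k) $$ (i, q) * B $$ (q, j) = 0"
        proof
          fix q assume q: "q \<in> {..<n} - {i, j}"
          then consider "q < j" | "j < q" by force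
          then show "(B ^\<^sub>m k) $$ (i, q) * B $$ (q, j) = 0"
            using low[of q i k] i q upper_triangularD[OF B(2), of j q] B(1) by cases auto
        qed
      qed (use i less.prems in auto)
      also have "\<dots> = c ^ k * B $$ (i, j) + (B ^\<^sub>m k) $$ (i, j) * c"
        using low[of i i k] i less.prems diag[of j] by simp
      finally show ?case using Suc by (simp add: algebra_simps)
    qed
    have "c ^ m = 1"
      using upper_triangular_pow(2)[OF B i, of m] m(2) i diag[OF i] by simp
    moreover have "(B ^\<^sub>m m) $$ (i, j) = 0"
      using m(2) i less.prems by simp
    ultimately show ?case using *[of m] m(1) by simp
  qed
  then have "B $$ (i, j) = (if i = j then c else 0)" if "i < n" "j < n" for i j
    using that diag[of i] upper_triangularD[OF B(2), of j i] B(1)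
    by (cases i j rule: linorder_cases) auto
  then show ?thesis using B(1) by (intro eq_matI) auto
qed

text \<open>Equality case of the triangle inequality. The mean \<open>u\<close> has modulus one, and
  the numbers \<open>1 - Re (e i * cnj u)\<close> are nonnegative with sum zero. For
  \<open>n = 0\<close> any constant will do.\<close>

lemma unit_complex_sum_extremal:
  fixes e :: "nat \<Rightarrow> complex"
  assumes e: "\<And>i. i < n \<Longrightarrow> cmod (e i) = 1" and sum: "cmod (\<Sum>i<n. e i) = of_nat n"
  obtains c where "\<And>i. i < n \<Longrightarrow> e i = c"
proof (cases "n = 0")
  case False
  define u where "u = (\<Sum>i<n. e i) / of_nat n"
  have u: "cmod u = 1" using sum False by (simp add: u_def norm_divide)
  then have uu: "u * cnj u = 1" by (simp add: complex_norm_square[symmetric])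
  have le: "Re (e i * cnj u) \<le> 1" if "i < n" for i
    using complex_Re_le_cmod[of "e i * cnj u"] e[OF that] u by (simp add: norm_mult)
  have "(\<Sum>i<n. 1 - Re (e i * cnj u)) = of_nat n - Re ((\<Sum>i<n. e i) * cnj u)"
    by (simp only: sum_subtractf sum_distrib_right Re_sum sum_constant card_lessThan mult_1_right)
  also have "(\<Sum>i<n. e i) * cnj u = of_nat n * (u * cnj u)"
    using False by (simp add: u_def)
  finally have "(\<Sum>i<n. 1 - Re (e i * cnj u)) = 0" using uu by simp
  then have Re1: "Re (e i * cnj u) = 1" if "i < n" for i
    using le that sum_nonneg_eq_0_iff[of "{..<n}" "\<lambda>i. 1 - Re (e i * cnj u)"] by auto
  have "e i = u" if i: "i < n" for i
  proof -
    have "cmod (e i * cnj u) = 1" using e[OF i] u by (simp add: norm_mult)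
    then have "e i * cnj u = 1"
      using Re1[OF i] by (intro complex_eqI) (auto simp: cmod_def)
    then have "e i * (u * cnj u) = u" by (simp add: algebra_simps)
    then show ?thesis using uu by simp
  qed
  then show ?thesis using that by blast
qed (use that in auto)

text \<open>In triangular form the diagonal entries are m-th roots of unity, so their (m-1)-st
  powers are their inverses and hence their conjugates. If the trace has modulus \<open>n\<close>,
  the diagonal is constant, and finite order forces the triangular form to be scalar.\<close>

lemma finite_order_mat:
  fixes A :: "complex mat"
  assumes A: "A \<in> carrier_mat n n" and m: "m > 0" "A ^\<^sub>m m = 1\<^sub>m n"
  shows mat_trace_finite_order_inverse: "mat_trace (A ^\<^sub>m (m - 1)) = cnj (mat_trace A)"
    and finite_order_mat_scalar: "cmod (mat_trace A) = of_nat n \<Longrightarrow> \<exists>c. A = c \<cdot>\<^sub>m 1\<^sub>m n"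
proof -
  obtain B P Q where sim: "similar_mat_wit A B P Q" and B: "B \<in> carrier_mat n n" "upper_triangular B"
    using complex_mat_similar_upper_triangular[OF A] by metis
  note s = similar_mat_witD2[OF A sim]
  have "similar_mat_wit (1\<^sub>m n) (B ^\<^sub>m m) P Q"
    using similar_mat_wit_pow[OF sim, of m] unfolding m(2) .
  then have "B ^\<^sub>m m = Q * 1\<^sub>m n * P"
    by (rule similar_mat_witD2(3)[OF pow_carrier_mat[OF B(1)] similar_mat_wit_sym])
  then have Bm: "B ^\<^sub>m m = 1\<^sub>m n" using s by simp
  define e where "e i = B $$ (i, i)" for i
  have em: "e i ^ m = 1" if "i < n" for i
    using upper_triangular_pow(2)[OF B that, of m] Bm that by (simp add: e_def)
  have norm: "cmod (e i) = 1" if "i < n" for i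
    using em[OF that] m(1) by (metis norm_one norm_power norm_ge_zero power_eq_1_iff order_less_irrefl)
  have trace: "mat_trace (A ^\<^sub>m k) = (\<Sum>i<n. e i ^ k)" for k
  proof -
    have "mat_trace (A ^\<^sub>m k) = mat_trace (B ^\<^sub>m k)"
      using A by (intro mat_trace_similar[OF _ similar_mat_wit_pow[OF sim]]) (rule pow_carrier_mat)
    also have "\<dots> = (\<Sum>i<n. e i ^ k)"
      using B by (simp add: mat_trace_carrier[of _ n] pow_carrier_mat upper_triangular_pow(2) e_def)
    finally show ?thesis .
  qed
  have trace1: "mat_trace A = (\<Sum>i<n. e i)" using trace[of 1] A by simp
  have "e i ^ (m - 1) = cnj (e i)" if "i < n" for i
  proof -
    have "e i * e i ^ (m - 1) = 1"
      using em[OF that] m(1) by (metis Suc_diff_1 power_Suc)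
    also have "1 = e i * cnj (e i)"
      using norm[OF that] by (simp add: complex_norm_square[symmetric])
    finally show ?thesis using norm[OF that] by auto
  qed
  then show "mat_trace (A ^\<^sub>m (m - 1)) = cnj (mat_trace A)"
    by (simp add: trace trace1)
  assume "cmod (mat_trace A) = of_nat n"
  then obtain c where c: "\<And>i. i < n \<Longrightarrow> e i = c"
    using unit_complex_sum_extremal[of n e] norm trace1 by auto
  have "B = c \<cdot>\<^sub>m 1\<^sub>m n"
    by (rule upper_triangular_finite_order_scalar[OF B _ m(1) Bm]) (use c in \<open>simp add: e_def\<close>)
  then have "A = P * (c \<cdot>\<^sub>m 1\<^sub>m n) * Q" using s(3) by simp
  also have "\<dots> = c \<cdot>\<^sub>m 1\<^sub>m n"
  proof -
    have "P * (c \<cdot>\<^sub>m 1\<^sub>m n) = c \<cdot>\<^sub>m P"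
      using s mult_smult_distrib[of P n n "1\<^sub>m n" n c] by simp
    then show ?thesis using s mult_smult_assoc_mat[of P n n Q n c] by simp
  qed
  finally show "\<exists>c. A = c \<cdot>\<^sub>m 1\<^sub>m n" by blast
qed

text \<open>The trace is the sum of the diagonal of a triangular form, whose entries are the
  eigenvalues; one of them must be nonzero.\<close>

lemma mat_trace_nonzero_eigenvalue:
  assumes A: "A \<in> carrier_mat n n" and "mat_trace A \<noteq> 0"
  obtains c where "c \<noteq> 0" "eigenvalue A c"
proof -
  obtain B P Q where sim: "similar_mat_wit A B P Q" and B: "B \<in> carrier_mat n n" "upper_triangular B"
    using complex_mat_similar_upper_triangular[OF A] by metis
  have "(\<Sum>i<n. B $$ (i, i)) \<noteq> 0"
    using assms mat_trace_similar[OF A sim] mat_trace_carrier[OF B(1)] by simp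
  then obtain i where "i \<in> {..<n}" and i: "B $$ (i, i) \<noteq> 0"
    by (rule sum.not_neutral_contains_not_neutral)
  then have "i < n" by simp
  have "char_poly A = char_poly B"
    by (rule char_poly_similar) (use sim in \<open>auto simp: similar_mat_def\<close>)
  also have "\<dots> = (\<Prod>a\<leftarrow>diag_mat B. [:- a, 1:])"
    by (rule char_poly_upper_triangular[OF B])
  finally have "poly (char_poly A) (B $$ (i, i)) = 0"
    using \<open>i < n\<close> B(1) by (auto simp: poly_prod_list prod_list_zero_iff diag_mat_def)
  then show ?thesis using that[OF i] eigenvalue_root_char_poly[OF A] by blast
qed

lemma mat_eqI_mult_vec:
  fixes A B :: "'a :: comm_ring_1 mat"
  assumes A: "A \<in> carrier_mat n m" and B: "B \<in> carrier_mat n m"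
    and eq: "\<And>v. v \<in> carrier_vec m \<Longrightarrow> A *\<^sub>v v = B *\<^sub>v v"
  shows "A = B"
proof (rule mat_col_eqI)
  fix j assume "j < dim_col B"
  then have j: "j < m" using B by simp
  have "M *\<^sub>v unit_vec m j = col M j" if "M \<in> carrier_mat n m" for M :: "'a mat"
    using that j by (intro eq_vecI) auto
  then show "col A j = col B j" using eq[of "unit_vec m j"] A B by auto
qed (use A B in auto)

lemma smult_one_mult_vec: "v \<in> carrier_vec n \<Longrightarrow> (c \<cdot>\<^sub>m 1\<^sub>m n) *\<^sub>v v = c \<cdot>\<^sub>v v"
  for c :: "'a :: comm_ring_1"
proof (rule eq_vecI)
  fix i assume v: "v \<in> carrier_vec n" and "i < dim_vec (c \<cdot>\<^sub>v v)"
  then have i: "i < n" by simp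
  have "((c \<cdot>\<^sub>m 1\<^sub>m n) *\<^sub>v v) $ i = (\<Sum>l<n. (c \<cdot>\<^sub>m 1\<^sub>m n) $$ (i, l) * v $ l)"
    using v i by (intro mat_mult_vec_index_sum) auto
  also have "\<dots> = (\<Sum>l<n. if l = i then c * v $ i else 0)"
    using i by (intro sum.cong) auto
  finally show "((c \<cdot>\<^sub>m 1\<^sub>m n) *\<^sub>v v) $ i = (c \<cdot>\<^sub>v v) $ i" using v i by simp
qed auto

lemma smult_one_mult: "A \<in> carrier_mat n m \<Longrightarrow> (c \<cdot>\<^sub>m 1\<^sub>m n) * A = c \<cdot>\<^sub>m A"
  for c :: "'a :: comm_ring_1"
  using mult_smult_assoc_mat[of "1\<^sub>m n" n n A m c] by simp

lemma mult_smult_one: "A \<in> carrier_mat m n \<Longrightarrow> A * (c \<cdot>\<^sub>m 1\<^sub>m n) = c \<cdot>\<^sub>m A"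
  for c :: "'a :: comm_ring_1"
  using mult_smult_distrib[of A m n "1\<^sub>m n" n c] by simp

lemma eigenspace_subspace:
  fixes A :: "'a :: field mat"
  assumes A: "A \<in> carrier_mat n n"
  shows "VectorSpace.subspace class_ring {v \<in> carrier_vec n. A *\<^sub>v v = c \<cdot>\<^sub>v v} (module_vec TYPE('a) n)"
proof -
  have "A *\<^sub>v (v + w) = c \<cdot>\<^sub>v (v + w)"
    if "v \<in> carrier_vec n" "A *\<^sub>v v = c \<cdot>\<^sub>v v" "w \<in> carrier_vec n" "A *\<^sub>v w = c \<cdot>\<^sub>v w" for v w
    using that by (simp add: mult_add_distrib_mat_vec[OF A] smult_add_distrib_vec[of _ n])
  moreover have "A *\<^sub>v (b \<cdot>\<^sub>v v) = c \<cdot>\<^sub>v (b \<cdot>\<^sub>v v)"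
    if "v \<in> carrier_vec n" "A *\<^sub>v v = c \<cdot>\<^sub>v v" for b v
    using that by (simp add: mult_mat_vec[OF A] smult_smult_assoc mult.commute)
  moreover have "A *\<^sub>v 0\<^sub>v n = c \<cdot>\<^sub>v 0\<^sub>v n"
    using A by (intro eq_vecI) auto
  ultimately show ?thesis by (auto simp: subspace_iff)
qed

lemma commute_imp_eigenspace_invariant:
  fixes A M :: "'a :: field mat"
  assumes A: "A \<in> carrier_mat n n" and M: "M \<in> carrier_mat n n" and comm: "M * A = A * M"
    and v: "v \<in> carrier_vec n" "A *\<^sub>v v = c \<cdot>\<^sub>v v"
  shows "A *\<^sub>v (M *\<^sub>v v) = c \<cdot>\<^sub>v (M *\<^sub>v v)"
proof -
  have "A *\<^sub>v (M *\<^sub>v v) = (A * M) *\<^sub>v v" using A M v by simp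
  also have "\<dots> = M *\<^sub>v (A *\<^sub>v v)" unfolding comm[symmetric] using A M v by simp
  also have "\<dots> = c \<cdot>\<^sub>v (M *\<^sub>v v)" using v by (simp add: mult_mat_vec[OF M])
  finally show ?thesis .
qed

lemma complex_mat_eigenvalue_exists:
  fixes A :: "complex mat"
  assumes A: "A \<in> carrier_mat n n" and n: "n > 0"
  obtains c where "eigenvalue A c"
proof -
  obtain as where as: "char_poly A = (\<Prod>a\<leftarrow>as. [:- a, 1:])" "length as = n"
    using char_poly_factorized[OF A] by blast
  then obtain a as' where "as = a # as'" using n by (cases as) auto
  then have "poly (char_poly A) a = 0" using as by simp
  then show ?thesis using that eigenvalue_root_char_poly[OF A] by blast
qed

subsection \<open>Irreducible representations of finite groups\<close>

text \<open>An invertible idempotent is the identity, which gives the value at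
  \<open>\<one>\<close>; conversely \<open>\<rho> (inv x)\<close> is the inverse that membership in
  \<open>GL n\<close> demands.\<close>

lemma (in group) representation_iff:
  "representation G n \<rho> \<longleftrightarrow>
    (\<forall>x\<in>carrier G. \<rho> x \<in> carrier_mat n n) \<and> \<rho> \<one> = 1\<^sub>m n \<and>
    (\<forall>x\<in>carrier G. \<forall>y\<in>carrier G. \<rho> (x \<otimes> y) = \<rho> x * \<rho> y)"
    (is "_ \<longleftrightarrow> ?rhs")
proof
  let ?R = "ring_mat TYPE(complex) n ()"
  have Units: "M \<in> Units ?R \<longleftrightarrow> M \<in> carrier_mat n n \<and>
      (\<exists>B\<in>carrier_mat n n. B * M = 1\<^sub>m n \<and> M * B = 1\<^sub>m n)" for M
    by (auto simp: Units_def ring_mat_simps)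
  {
    assume "representation G n \<rho>"
    then have U: "\<rho> x \<in> Units ?R" and mult: "y \<in> carrier G \<Longrightarrow> \<rho> (x \<otimes> y) = \<rho> x * \<rho> y"
      if "x \<in> carrier G" for x y
      using that unfolding representation_def GL_def hom_def
      by (auto simp: units_of_carrier units_of_mult ring_mat_simps)
    from U[OF one_closed] obtain B where B: "B \<in> carrier_mat n n" "B * \<rho> \<one> = 1\<^sub>m n"
      and 1: "\<rho> \<one> \<in> carrier_mat n n"
      by (auto simp: Units)
    have "\<rho> \<one> = B * \<rho> \<one> * \<rho> \<one>" using B 1 by simp
    also have "\<dots> = B * (\<rho> \<one> * \<rho> \<one>)" using B(1) 1 by (rule assoc_mult_mat) (rule 1)
    also have "\<dots> = 1\<^sub>m n" using mult[OF one_closed one_closed] B by simp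
    finally show ?rhs using U mult by (auto simp: Units)
  }
  assume r: ?rhs
  have "\<rho> x \<in> Units ?R" if x: "x \<in> carrier G" for x
  proof -
    have "\<rho> (inv x) * \<rho> x = 1\<^sub>m n" "\<rho> x * \<rho> (inv x) = 1\<^sub>m n"
      using r x by (metis inv_closed l_inv, metis inv_closed r_inv)
    then show ?thesis using r x inv_closed[OF x] unfolding Units by blast
  qed
  then show "representation G n \<rho>"
    using r unfolding representation_def GL_def hom_def
    by (auto simp: units_of_carrier units_of_mult ring_mat_simps)
qed

definition class_function :: "('a, 'b) monoid_scheme \<Rightarrow> ('a \<Rightarrow> complex) \<Rightarrow> bool" where
  "class_function G f \<longleftrightarrow>
    (\<forall>x\<in>carrier G. \<forall>h\<in>carrier G. f (h \<otimes>\<^bsub>G\<^esub> x \<otimes>\<^bsub>G\<^esub> inv\<^bsub>G\<^esub> h) = f x)"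

lemma (in group) class_function_commute:
  assumes f: "class_function G f" and x: "x \<in> carrier G" and y: "y \<in> carrier G"
  shows "f (x \<otimes> y) = f (y \<otimes> x)"
proof -
  have "x \<otimes> (y \<otimes> x) \<otimes> inv x = x \<otimes> y"
    using x y by (simp add: m_assoc)
  then show ?thesis using f x y unfolding class_function_def by (metis m_closed)
qed

text \<open>The image of the group algebra element with coefficients \<open>f\<close> under the
  linear extension of \<open>\<rho>\<close>, in other words the Fourier transform of
  \<open>f\<close> at \<open>\<rho>\<close>.\<close>

definition rep_sum :: "('a, 'b) monoid_scheme \<Rightarrow> nat \<Rightarrow> ('a \<Rightarrow> complex mat) \<Rightarrow> ('a \<Rightarrow> complex) \<Rightarrow> complex mat"
  where "rep_sum G n \<rho> f = mat_sum n n (carrier G) (\<lambda>x. f x \<cdot>\<^sub>m \<rho> x)"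

text \<open>The centre of the representation. It is the form of Z(\<chi>) in which products,
  inverses and commutators are easy to control.\<close>

definition scalar_elements :: "('a, 'b) monoid_scheme \<Rightarrow> nat \<Rightarrow> ('a \<Rightarrow> complex mat) \<Rightarrow> 'a set" where
  "scalar_elements G n \<rho> = {g \<in> carrier G. \<exists>c. \<rho> g = c \<cdot>\<^sub>m 1\<^sub>m n}"

locale finite_group = group +
  assumes finite_carrier: "finite (carrier G)"
begin

lemma order_pos: "Coset.order G > 0"
  using finite_carrier by (simp add: order_gt_0_iff_finite)

lemma bij_betw_left_mult: "h \<in> carrier G \<Longrightarrow> bij_betw (\<lambda>x. h \<otimes> x) (carrier G) (carrier G)"
  by (rule bij_betw_byWitness[where f' = "\<lambda>x. inv h \<otimes> x"]) (auto simp flip: m_assoc)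

lemma bij_betw_right_mult: "h \<in> carrier G \<Longrightarrow> bij_betw (\<lambda>x. x \<otimes> h) (carrier G) (carrier G)"
  by (rule bij_betw_byWitness[where f' = "\<lambda>x. x \<otimes> inv h"]) (auto simp: m_assoc)

end

locale finite_group_irrep = finite_group +
  fixes n :: nat and \<rho> :: "'a \<Rightarrow> complex mat"
  assumes irreducible: "irreducible_representation G n \<rho>"
begin

lemma degree_pos: "n > 0"
  using irreducible by (simp add: irreducible_representation_def)

lemma rep_carrier [simp]: "x \<in> carrier G \<Longrightarrow> \<rho> x \<in> carrier_mat n n"
  and rep_one [simp]: "\<rho> \<one> = 1\<^sub>m n"
  and rep_mult: "x \<in> carrier G \<Longrightarrow> y \<in> carrier G \<Longrightarrow> \<rho> (x \<otimes> y) = \<rho> x * \<rho> y"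
  using irreducible by (simp_all add: irreducible_representation_def representation_iff)

lemma rep_dim [simp]: "x \<in> carrier G \<Longrightarrow> dim_row (\<rho> x) = n" "x \<in> carrier G \<Longrightarrow> dim_col (\<rho> x) = n"
  using rep_carrier by blast+

lemma rep_inv_mult [simp]:
  "x \<in> carrier G \<Longrightarrow> \<rho> x * \<rho> (inv x) = 1\<^sub>m n"
  "x \<in> carrier G \<Longrightarrow> \<rho> (inv x) * \<rho> x = 1\<^sub>m n"
  by (simp_all flip: rep_mult)

lemma rep_pow: "x \<in> carrier G \<Longrightarrow> \<rho> (x [^] (k :: nat)) = \<rho> x ^\<^sub>m k"
  by (induction k) (auto simp: rep_mult)

text \<open>An eigenspace of \<open>T\<close> is invariant because \<open>T\<close> commutes with
  the representation; being nonzero, it is the whole space.\<close>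

lemma schur:
  assumes T: "T \<in> carrier_mat n n" and comm: "\<And>x. x \<in> carrier G \<Longrightarrow> \<rho> x * T = T * \<rho> x"
  obtains c where "T = c \<cdot>\<^sub>m 1\<^sub>m n"
proof -
  obtain c where "eigenvalue T c"
    using complex_mat_eigenvalue_exists[OF T degree_pos] .
  then obtain w where w: "w \<in> carrier_vec n" "w \<noteq> 0\<^sub>v n" "T *\<^sub>v w = c \<cdot>\<^sub>v w"
    using T by (auto simp: eigenvalue_def eigenvector_def)
  let ?W = "{v \<in> carrier_vec n. T *\<^sub>v v = c \<cdot>\<^sub>v v}"
  have "invariant_subspace G n \<rho> ?W"
    unfolding invariant_subspace_def
    using eigenspace_subspace[OF T] commute_imp_eigenspace_invariant[OF T rep_carrier comm]
    by (auto intro!: mult_mat_vec_carrier[of _ n n])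
  then have "?W = {0\<^sub>v n} \<or> ?W = carrier_vec n"
    using irreducible unfolding irreducible_representation_def by blast
  then have W: "?W = carrier_vec n" using w by blast
  have "T = c \<cdot>\<^sub>m 1\<^sub>m n"
  proof (rule mat_eqI_mult_vec[OF T])
    fix v :: "complex vec" assume v: "v \<in> carrier_vec n"
    then have "T *\<^sub>v v = c \<cdot>\<^sub>v v" using W by blast
    then show "T *\<^sub>v v = (c \<cdot>\<^sub>m 1\<^sub>m n) *\<^sub>v v" using smult_one_mult_vec[OF v] by simp
  qed simp
  then show ?thesis by (rule that)
qed

text \<open>Averaging over conjugates produces a matrix that commutes with the representation, so
  Schur's lemma makes it scalar. The constant comes from the trace: each of the |G| summands has the
  trace of \<open>M\<close>.\<close>

lemma rep_average_scalar:
  assumes M: "M \<in> carrier_mat n n"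
  shows "mat_sum n n (carrier G) (\<lambda>x. \<rho> x * M * \<rho> (inv x)) =
    (of_nat (Coset.order G) * mat_trace M / of_nat n) \<cdot>\<^sub>m 1\<^sub>m n" (is "?T = _")
proof -
  have c: "\<rho> x * M * \<rho> (inv x) \<in> carrier_mat n n" if "x \<in> carrier G" for x
    using that M by (auto intro!: mult_carrier_mat[of _ n n])
  have "\<rho> h * ?T = ?T * \<rho> h" if h: "h \<in> carrier G" for h
  proof -
    have "\<rho> h * ?T = mat_sum n n (carrier G) (\<lambda>x. \<rho> h * (\<rho> x * M * \<rho> (inv x)))"
      using h c by (simp add: mat_mult_mat_sum[of _ n n])
    also have "\<dots> = mat_sum n n (carrier G) (\<lambda>x. \<rho> (h \<otimes> x) * M * \<rho> (inv (h \<otimes> x)) * \<rho> h)"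
    proof (rule mat_sum_cong)
      fix x assume x: "x \<in> carrier G"
      \<comment> \<open>This moves \<open>\<rho> h\<close> to the right end of each summand and
        leaves an expression in \<open>h \<otimes> x\<close>, ready for reindexing.\<close>
      have "inv x = inv (h \<otimes> x) \<otimes> h"
        using h x by (simp add: inv_mult_group m_assoc)
      then have "\<rho> (inv x) = \<rho> (inv (h \<otimes> x)) * \<rho> h"
        using h x by (metis inv_closed m_closed rep_mult)
      then show "\<rho> h * (\<rho> x * M * \<rho> (inv x)) = \<rho> (h \<otimes> x) * M * \<rho> (inv (h \<otimes> x)) * \<rho> h"
        using h x M
        by (simp add: rep_mult mult_carrier_mat[of _ n n _ n] flip: assoc_mult_mat[of _ n n _ n _ n])
    qed
    also have "\<dots> = mat_sum n n (carrier G) (\<lambda>x. \<rho> x * M * \<rho> (inv x) * \<rho> h)"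
      by (rule mat_sum_reindex_bij_betw[OF bij_betw_left_mult[OF h]])
    also have "\<dots> = ?T * \<rho> h"
      using h c by (simp add: mat_sum_mult_mat[of _ n n])
    finally show ?thesis .
  qed
  then obtain a where a: "?T = a \<cdot>\<^sub>m 1\<^sub>m n"
    using schur[of ?T] by auto
  have "mat_trace (\<rho> x * M * \<rho> (inv x)) = mat_trace M" if x: "x \<in> carrier G" for x
  proof -
    have "mat_trace (\<rho> x * M * \<rho> (inv x)) = mat_trace (\<rho> (inv x) * (\<rho> x * M))"
      using x M by (intro mat_trace_mult_commute[of _ n n]) auto
    also have "\<rho> (inv x) * (\<rho> x * M) = M"
      using x M by (simp flip: assoc_mult_mat[of _ n n _ n _ n])
    finally show ?thesis .
  qed
  then have "mat_trace ?T = of_nat (Coset.order G) * mat_trace M"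
    using c by (simp add: mat_trace_mat_sum Coset.order_def)
  then have "of_nat n * a = of_nat (Coset.order G) * mat_trace M"
    using a by (simp add: mat_trace_smult_one)
  then have "a = of_nat (Coset.order G) * mat_trace M / of_nat n"
    using degree_pos by (simp add: field_simps)
  then show ?thesis using a by simp
qed

text \<open>Averaging matrix units gives the orthogonality of the diagonal matrix coefficients, and
  summing over all pairs of diagonal positions gives that of the character.\<close>

lemma character_orthogonality:
  "(\<Sum>x\<in>carrier G. mat_trace (\<rho> x) * mat_trace (\<rho> (inv x))) = of_nat (Coset.order G)"
proof -
  have entry: "(\<Sum>x\<in>carrier G. \<rho> x $$ (i, i) * \<rho> (inv x) $$ (j, j)) =
      (if i = j then of_nat (Coset.order G) / of_nat n else 0)" if ij: "i < n" "j < n" for i j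
  proof -
    \<comment> \<open>The matrix unit at (i, j): the (i, j) entry of its average isolates the
      product of the two diagonal coefficients, and its trace is 1 exactly when i = j.\<close>
    define E :: "complex mat" where "E = mat n n (\<lambda>(a, b). if a = i \<and> b = j then 1 else 0)"
    have E: "E \<in> carrier_mat n n" by (simp add: E_def)
    have XE: "(\<rho> x * E) $$ (i, b) = (if b = j then \<rho> x $$ (i, i) else 0)"
      if "x \<in> carrier G" "b < n" for x b
    proof -
      have "(\<rho> x * E) $$ (i, b) = (\<Sum>l<n. if l = i then (if b = j then \<rho> x $$ (i, i) else 0) else 0)"
        unfolding mat_mult_index_sum[OF rep_carrier[OF that(1)] E ij(1) that(2)]
        using that ij by (intro sum.cong) (auto simp: E_def)
      then show ?thesis using ij by simp
    qed
    have "(\<rho> x * E * \<rho> (inv x)) $$ (i, j) = \<rho> x $$ (i, i) * \<rho> (inv x) $$ (j, j)"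
      if x: "x \<in> carrier G" for x
    proof -
      have "(\<rho> x * E * \<rho> (inv x)) $$ (i, j) = (\<Sum>l<n. (\<rho> x * E) $$ (i, l) * \<rho> (inv x) $$ (l, j))"
        using x E ij by (intro mat_mult_index_sum mult_carrier_mat[of _ n n]) auto
      also have "\<dots> = (\<Sum>l<n. if l = j then \<rho> x $$ (i, i) * \<rho> (inv x) $$ (j, j) else 0)"
        using x by (intro sum.cong) (auto simp: XE simp del: index_mult_mat)
      finally show ?thesis using ij by simp
    qed
    then have "(\<Sum>x\<in>carrier G. \<rho> x $$ (i, i) * \<rho> (inv x) $$ (j, j)) =
        mat_sum n n (carrier G) (\<lambda>x. \<rho> x * E * \<rho> (inv x)) $$ (i, j)"
      using ij by (simp add: mat_sum_index del: index_mult_mat)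
    also have "\<dots> = of_nat (Coset.order G) * mat_trace E / of_nat n * (if i = j then 1 else 0)"
      unfolding rep_average_scalar[OF E] using ij by simp
    also have "mat_trace E = (if i = j then 1 else 0)"
    proof -
      have "mat_trace E = (\<Sum>a<n. if a = i then (if i = j then 1 else 0) else 0)"
        unfolding mat_trace_carrier[OF E] by (intro sum.cong) (auto simp: E_def)
      then show ?thesis using ij by simp
    qed
    finally show ?thesis by simp
  qed
  have "(\<Sum>x\<in>carrier G. mat_trace (\<rho> x) * mat_trace (\<rho> (inv x))) =
      (\<Sum>x\<in>carrier G. \<Sum>i<n. \<Sum>j<n. \<rho> x $$ (i, i) * \<rho> (inv x) $$ (j, j))"
    by (rule sum.cong) (simp_all add: mat_trace_carrier[of _ n] sum_product)
  also have "\<dots> = (\<Sum>i<n. \<Sum>x\<in>carrier G. \<Sum>j<n. \<rho> x $$ (i, i) * \<rho> (inv x) $$ (j, j))"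
    by (rule sum.swap)
  also have "\<dots> = (\<Sum>i<n. \<Sum>j<n. \<Sum>x\<in>carrier G. \<rho> x $$ (i, i) * \<rho> (inv x) $$ (j, j))"
    by (rule sum.cong[OF refl]) (rule sum.swap)
  also have "\<dots> = (\<Sum>i<n. \<Sum>j<n. if i = j then of_nat (Coset.order G) / of_nat n else 0)"
    by (simp add: entry)
  also have "\<dots> = of_nat (Coset.order G)"
    using degree_pos by simp
  finally show ?thesis .
qed

lemma rep_pow_order: "x \<in> carrier G \<Longrightarrow> \<rho> x ^\<^sub>m Coset.order G = 1\<^sub>m n"
  by (simp add: pow_order_eq_1 flip: rep_pow)

text \<open>The inverse of \<open>x\<close> is its power with exponent |G| - 1, so the statement on
  traces of finite-order matrices applies.\<close>

lemma character_inv: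
  assumes x: "x \<in> carrier G"
  shows "mat_trace (\<rho> (inv x)) = cnj (mat_trace (\<rho> x))"
proof -
  have "x [^] (Coset.order G - 1) \<otimes> x = \<one>"
    using x order_pos pow_order_eq_1[OF x] by (metis Suc_diff_1 nat_pow_Suc)
  then have "x [^] (Coset.order G - 1) = inv x"
    using x by (metis inv_equality nat_pow_closed)
  then have "\<rho> (inv x) = \<rho> x ^\<^sub>m (Coset.order G - 1)" using x by (metis rep_pow)
  then show ?thesis
    using mat_trace_finite_order_inverse[OF rep_carrier[OF x] order_pos rep_pow_order[OF x]] by simp
qed

lemma sum_norm_character:
  "(\<Sum>x\<in>carrier G. (cmod (mat_trace (\<rho> x)))\<^sup>2) = of_nat (Coset.order G)"
proof -
  have "of_real (\<Sum>x\<in>carrier G. (cmod (mat_trace (\<rho> x)))\<^sup>2) = (of_nat (Coset.order G) :: complex)"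
    unfolding character_orthogonality[symmetric] of_real_sum
    by (rule sum.cong) (simp_all add: character_inv complex_norm_square[symmetric])
  then show ?thesis by (metis of_real_eq_iff of_real_of_nat_eq)
qed

lemma character_one: "character_of G \<rho> \<one> = of_nat n"
  by (simp add: character_of_def mat_trace_one)

text \<open>Taking traces in \<rho>(x) \<rho>(x^-1) = 1 for a scalar \<rho>(x) = c gives n = c n
  cnj(c), hence |c| = 1.\<close>

lemma scalar_element_norm:
  assumes "x \<in> scalar_elements G n \<rho>"
  shows "cmod (mat_trace (\<rho> x)) = of_nat n"
proof -
  obtain c where x: "x \<in> carrier G" and c: "\<rho> x = c \<cdot>\<^sub>m 1\<^sub>m n"
    using assms by (auto simp: scalar_elements_def)
  have t: "mat_trace (\<rho> x) = of_nat n * c" by (simp add: c mat_trace_smult_one)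
  have "1\<^sub>m n = c \<cdot>\<^sub>m \<rho> (inv x)"
    using rep_inv_mult(1)[OF x] x by (simp add: c smult_one_mult[of _ n n])
  then have "mat_trace (1\<^sub>m n) = c * mat_trace (\<rho> (inv x))"
    using x by (simp add: mat_trace_smult[of _ n])
  then have "of_nat n = c * (of_nat n * cnj c)"
    using character_inv[OF x] t by (simp add: mat_trace_one)
  then have "c * cnj c = 1" using degree_pos by (simp add: field_simps)
  then have "cmod c = 1" by (metis complex_mod_sqrt_Re_mult_cnj one_complex.sel(1) real_sqrt_one)
  then show ?thesis by (simp add: t norm_mult)
qed

text \<open>Maximal modulus of the trace forces a matrix of finite order to be scalar; in the other
  direction the scalar has modulus one.\<close>

lemma character_center_eq: "character_center G (character_of G \<rho>) = scalar_elements G n \<rho>"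
proof -
  have "x \<in> scalar_elements G n \<rho>" if "x \<in> carrier G" "cmod (mat_trace (\<rho> x)) = of_nat n" for x
    using finite_order_mat_scalar[OF rep_carrier[OF that(1)] order_pos rep_pow_order] that
    by (auto simp: scalar_elements_def)
  moreover have "complex_of_real r = of_nat n \<longleftrightarrow> r = of_nat n" for r
    by (metis of_real_eq_iff of_real_of_nat_eq)
  ultimately show ?thesis
    using scalar_element_norm
    by (auto simp: character_center_def character_one character_of_def mat_trace_one scalar_elements_def)
qed

text \<open>Makes Lagrange's theorem available for the index of Z(\<chi>).\<close>

lemma subgroup_scalar_elements: "subgroup (scalar_elements G n \<rho>) G"
proof (rule subgroupI)
  show "scalar_elements G n \<rho> \<noteq> {}"
    by (auto simp: scalar_elements_def intro!: exI[of _ \<one>] exI[of _ 1])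
next
  fix x assume "x \<in> scalar_elements G n \<rho>"
  then obtain c where x: "x \<in> carrier G" and c: "\<rho> x = c \<cdot>\<^sub>m 1\<^sub>m n"
    by (auto simp: scalar_elements_def)
  have 1: "c \<cdot>\<^sub>m \<rho> (inv x) = 1\<^sub>m n"
    using rep_inv_mult(1)[OF x] x by (simp add: c smult_one_mult[of _ n n])
  have "mat_trace (1\<^sub>m n) = c * mat_trace (\<rho> (inv x))"
    using x by (simp add: mat_trace_smult[of _ n] flip: 1)
  then have "c \<noteq> 0" using degree_pos by (auto simp: mat_trace_one)
  have "\<rho> (inv x) = (1 / c) \<cdot>\<^sub>m (c \<cdot>\<^sub>m \<rho> (inv x))"
    using \<open>c \<noteq> 0\<close> by (intro eq_matI) auto
  then have "\<rho> (inv x) = (1 / c) \<cdot>\<^sub>m 1\<^sub>m n" unfolding 1 .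
  then show "inv x \<in> scalar_elements G n \<rho>" using x by (auto simp: scalar_elements_def)
next
  fix x y assume "x \<in> scalar_elements G n \<rho>" "y \<in> scalar_elements G n \<rho>"
  then obtain c d where "x \<in> carrier G" "\<rho> x = c \<cdot>\<^sub>m 1\<^sub>m n" "y \<in> carrier G" "\<rho> y = d \<cdot>\<^sub>m 1\<^sub>m n"
    by (auto simp: scalar_elements_def)
  then have "\<rho> (x \<otimes> y) = (c * d) \<cdot>\<^sub>m 1\<^sub>m n"
    by (simp add: rep_mult smult_one_mult[of _ n n]) (intro eq_matI; auto)
  then show "x \<otimes> y \<in> scalar_elements G n \<rho>"
    using \<open>x \<in> carrier G\<close> \<open>y \<in> carrier G\<close> by (auto simp: scalar_elements_def)
qed (auto simp: scalar_elements_def)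

text \<open>In the sum of |\<chi>|^2 over \<open>G\<close>, which equals |G|, the elements of Z
  contribute n^2 |Z|. With r the index of Z, the remaining nonnegative terms add up to (r - n^2)
  |Z|, so they all vanish exactly when n^2 = r.\<close>

lemma degree_eq_sqrt_index_iff:
  "character_of G \<rho> \<one> =
      complex_of_real (sqrt (real (card (rcosets (character_center G (character_of G \<rho>)))))) \<longleftrightarrow>
    (\<forall>x\<in>carrier G - scalar_elements G n \<rho>. mat_trace (\<rho> x) = 0)"
proof -
  define Z where "Z = scalar_elements G n \<rho>"
  have Z: "Z \<subseteq> carrier G" "finite Z" "\<one> \<in> Z"
    using subgroup.subset[OF subgroup_scalar_elements] finite_carrier finite_subset
      subgroup.one_closed[OF subgroup_scalar_elements]
    by (auto simp: Z_def)
  define r where "r = card (rcosets Z)"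
  have r: "r * card Z = Coset.order G"
    unfolding r_def Z_def by (rule lagrange[OF subgroup_scalar_elements])
  have "real n ^ 2 * card Z + (\<Sum>x\<in>carrier G - Z. (cmod (mat_trace (\<rho> x)))\<^sup>2) = Coset.order G"
  proof -
    have "(\<Sum>x\<in>Z. (cmod (mat_trace (\<rho> x)))\<^sup>2) = (\<Sum>x\<in>Z. real n ^ 2)"
      by (rule sum.cong) (auto simp: Z_def scalar_element_norm)
    then show ?thesis
      using sum.subset_diff[OF Z(1) finite_carrier, of "\<lambda>x. (cmod (mat_trace (\<rho> x)))\<^sup>2"]
      by (simp add: sum_norm_character mult.commute)
  qed
  then have split: "(\<Sum>x\<in>carrier G - Z. (cmod (mat_trace (\<rho> x)))\<^sup>2) = (real r - real n ^ 2) * card Z"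
    unfolding r[symmetric] by (simp add: algebra_simps)
  have "(\<forall>x\<in>carrier G - Z. mat_trace (\<rho> x) = 0) \<longleftrightarrow>
      (\<Sum>x\<in>carrier G - Z. (cmod (mat_trace (\<rho> x)))\<^sup>2) = 0"
    using finite_carrier by (subst sum_nonneg_eq_0_iff) auto
  also have "\<dots> \<longleftrightarrow> real r = real n ^ 2"
    unfolding split using Z by auto
  also have "\<dots> \<longleftrightarrow> real n = sqrt (real r)"
    by (metis of_nat_0_le_iff real_sqrt_pow2 real_sqrt_abs abs_of_nat)
  also have "\<dots> \<longleftrightarrow> character_of G \<rho> \<one> = complex_of_real (sqrt (real r))"
    unfolding character_one by (metis of_real_eq_iff of_real_of_nat_eq)
  finally show ?thesis unfolding character_center_eq r_def Z_def by blast
qed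

text \<open>Class functions are central in the group algebra: conjugating by \<open>h\<close> merely
  permutes the summands. Schur's lemma then applies, and the trace determines the scalar.\<close>

lemma rep_sum_scalar:
  assumes f: "class_function G f"
  obtains c where "rep_sum G n \<rho> f = c \<cdot>\<^sub>m 1\<^sub>m n" "(\<Sum>x\<in>carrier G. f x * mat_trace (\<rho> x)) = of_nat n * c"
proof -
  have c: "f x \<cdot>\<^sub>m \<rho> x \<in> carrier_mat n n" if "x \<in> carrier G" for x
    using that by simp
  have "\<rho> h * rep_sum G n \<rho> f = rep_sum G n \<rho> f * \<rho> h" if h: "h \<in> carrier G" for h
  proof -
    let ?k = "\<lambda>x. h \<otimes> x \<otimes> inv h"
    have bij: "bij_betw ?k (carrier G) (carrier G)"
      using bij_betw_trans[OF bij_betw_left_mult[OF h] bij_betw_right_mult[of "inv h"]] h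
      by (simp add: comp_def)
    have "\<rho> h * rep_sum G n \<rho> f = mat_sum n n (carrier G) (\<lambda>x. \<rho> h * (f x \<cdot>\<^sub>m \<rho> x))"
      unfolding rep_sum_def using h c by (simp add: mat_mult_mat_sum[of _ n n])
    also have "\<dots> = mat_sum n n (carrier G) (\<lambda>x. (f (?k x) \<cdot>\<^sub>m \<rho> (?k x)) * \<rho> h)"
    proof (rule mat_sum_cong)
      fix x assume x: "x \<in> carrier G"
      have fx: "f (?k x) = f x" using f x h unfolding class_function_def by blast
      have "?k x \<otimes> h = h \<otimes> x" using x h by (simp add: m_assoc)
      then have "\<rho> (?k x) * \<rho> h = \<rho> h * \<rho> x"
        using x h by (metis inv_closed m_closed rep_mult)
      then show "\<rho> h * (f x \<cdot>\<^sub>m \<rho> x) = (f (?k x) \<cdot>\<^sub>m \<rho> (?k x)) * \<rho> h"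
        using x h mult_smult_distrib[of "\<rho> h" n n "\<rho> x" n] mult_smult_assoc_mat[of "\<rho> (?k x)" n n "\<rho> h" n]
        by (simp add: fx)
    qed
    also have "\<dots> = mat_sum n n (carrier G) (\<lambda>x. (f x \<cdot>\<^sub>m \<rho> x) * \<rho> h)"
      by (rule mat_sum_reindex_bij_betw[OF bij])
    also have "\<dots> = rep_sum G n \<rho> f * \<rho> h"
      unfolding rep_sum_def using h c by (simp add: mat_sum_mult_mat[of _ n n])
    finally show ?thesis .
  qed
  then obtain a where a: "rep_sum G n \<rho> f = a \<cdot>\<^sub>m 1\<^sub>m n"
    using schur[of "rep_sum G n \<rho> f"] by (auto simp: rep_sum_def)
  have "(\<Sum>x\<in>carrier G. f x * mat_trace (\<rho> x)) = mat_trace (rep_sum G n \<rho> f)"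
    unfolding rep_sum_def using c by (simp add: mat_trace_mat_sum mat_trace_smult[of _ n])
  then show ?thesis using that[OF a] by (simp add: a mat_trace_smult_one)
qed

text \<open>Right multiplication by \<open>\<rho> h\<close> only reindexes the operator of
  \<open>f\<close>. This operator is a scalar, nonzero by the last assumption, and can be
  cancelled.\<close>

lemma class_function_right_invariant_kernel:
  assumes f: "class_function G f" and h: "h \<in> carrier G"
    and inv: "\<And>x. x \<in> carrier G \<Longrightarrow> f (x \<otimes> h) = f x"
    and nz: "(\<Sum>x\<in>carrier G. f x * mat_trace (\<rho> x)) \<noteq> 0"
  shows "\<rho> h = 1\<^sub>m n"
proof -
  obtain c where c: "rep_sum G n \<rho> f = c \<cdot>\<^sub>m 1\<^sub>m n"
    and "(\<Sum>x\<in>carrier G. f x * mat_trace (\<rho> x)) = of_nat n * c"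
    using rep_sum_scalar[OF f] .
  then have "c \<noteq> 0" using nz by auto
  have "rep_sum G n \<rho> f * \<rho> h = mat_sum n n (carrier G) (\<lambda>x. f x \<cdot>\<^sub>m \<rho> x * \<rho> h)"
    unfolding rep_sum_def using h by (simp add: mat_sum_mult_mat[of _ n n])
  also have "\<dots> = mat_sum n n (carrier G) (\<lambda>x. f (x \<otimes> h) \<cdot>\<^sub>m \<rho> (x \<otimes> h))"
    using h mult_smult_assoc_mat[of _ n n "\<rho> h" n]
    by (intro mat_sum_cong) (simp add: inv rep_mult)
  also have "\<dots> = rep_sum G n \<rho> f"
    unfolding rep_sum_def by (rule mat_sum_reindex_bij_betw[OF bij_betw_right_mult[OF h]])
  finally have "c \<cdot>\<^sub>m \<rho> h = c \<cdot>\<^sub>m 1\<^sub>m n"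
    using h by (simp add: c smult_one_mult[of _ n n])
  then have "(1 / c) \<cdot>\<^sub>m (c \<cdot>\<^sub>m \<rho> h) = (1 / c) \<cdot>\<^sub>m (c \<cdot>\<^sub>m 1\<^sub>m n)" by simp
  moreover have "(1 / c) \<cdot>\<^sub>m (c \<cdot>\<^sub>m M) = M" for M :: "complex mat"
    using \<open>c \<noteq> 0\<close> by (intro eq_matI) auto
  ultimately show ?thesis by simp
qed

text \<open>Since [g,x] = (xg)^-1 (gx), its image is trivial exactly when the images of
  \<open>g\<close> and \<open>x\<close> commute; commuting with all of them means being scalar by
  Schur's lemma.\<close>

lemma scalar_elements_iff_commutator:
  assumes g: "g \<in> carrier G"
  shows "g \<in> scalar_elements G n \<rho> \<longleftrightarrow> (\<forall>x\<in>carrier G. \<rho> (commutator G g x) = 1\<^sub>m n)"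
proof -
  have com: "commutator G g x \<in> carrier G" "x \<otimes> g \<otimes> commutator G g x = g \<otimes> x"
    if x: "x \<in> carrier G" for x
  proof -
    show "commutator G g x \<in> carrier G" using g x by (simp add: commutator_def)
    have "x \<otimes> g \<otimes> (inv g \<otimes> inv x \<otimes> (g \<otimes> x)) = g \<otimes> x"
      using g x by (simp flip: m_assoc) (simp add: m_assoc)
    then show "x \<otimes> g \<otimes> commutator G g x = g \<otimes> x"
      using g x by (simp add: commutator_def m_assoc)
  qed
  show ?thesis
  proof
    assume "g \<in> scalar_elements G n \<rho>"
    then obtain c where c: "\<rho> g = c \<cdot>\<^sub>m 1\<^sub>m n" by (auto simp: scalar_elements_def)
    show "\<forall>x\<in>carrier G. \<rho> (commutator G g x) = 1\<^sub>m n"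
    proof
      fix x assume x: "x \<in> carrier G"
      have "\<rho> g * \<rho> x = \<rho> x * \<rho> g"
        using x by (simp add: c smult_one_mult[of _ n n] mult_smult_one[of _ n n])
      then have "\<rho> (g \<otimes> x) = \<rho> (x \<otimes> g)" using x g by (simp add: rep_mult)
      moreover have "commutator G g x = inv (x \<otimes> g) \<otimes> (g \<otimes> x)"
        using x g by (simp add: commutator_def inv_mult_group m_assoc)
      ultimately show "\<rho> (commutator G g x) = 1\<^sub>m n"
        using x g by (simp add: rep_mult[of "inv (x \<otimes> g)"])
    qed
  next
    assume 1: "\<forall>x\<in>carrier G. \<rho> (commutator G g x) = 1\<^sub>m n"
    have "\<rho> x * \<rho> g = \<rho> g * \<rho> x" if x: "x \<in> carrier G" for x
    proof -
      have "\<rho> g * \<rho> x = \<rho> (x \<otimes> g \<otimes> commutator G g x)" using com[OF x] x g by (simp add: rep_mult)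
      also have "\<dots> = \<rho> (x \<otimes> g) * \<rho> (commutator G g x)"
        using com[OF x] x g by (intro rep_mult) auto
      also have "\<dots> = \<rho> x * \<rho> g" using 1 x g right_mult_one_mat[of "\<rho> (x \<otimes> g)" n n] by (simp add: rep_mult)
      finally show ?thesis by simp
    qed
    then show "g \<in> scalar_elements G n \<rho>"
      using schur[OF rep_carrier[OF g]] g unfolding scalar_elements_def by blast
  qed
qed

end

subsection \<open>Constituents of the regular representation\<close>

lemma factor_through_mat:
  fixes X P :: "'a :: comm_ring_1 mat"
  assumes X: "X \<in> carrier_mat n k" and P: "P \<in> carrier_mat n m"
    and image: "\<And>v. v \<in> carrier_vec k \<Longrightarrow> X *\<^sub>v v \<in> (\<lambda>w. P *\<^sub>v w) ` carrier_vec m"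
  shows "\<exists>R\<in>carrier_mat m k. X = P * R"
proof -
  \<comment> \<open>No bound on \<open>j\<close> is required: for \<open>j \<ge> k\<close> the
    vector \<open>unit_vec k j\<close> is zero but still has the right size. So the choice of
    \<open>r\<close> is total.\<close>
  have "\<exists>w\<in>carrier_vec m. X *\<^sub>v unit_vec k j = P *\<^sub>v w" for j
    using image[of "unit_vec k j"] by auto
  then obtain r where r: "r j \<in> carrier_vec m" "X *\<^sub>v unit_vec k j = P *\<^sub>v r j" for j
    by metis
  define R where "R = mat m k (\<lambda>(i, j). r j $ i)"
  have R: "R \<in> carrier_mat m k" by (simp add: R_def)
  have "X = P * R"
  proof (rule mat_col_eqI)
    fix j assume "j < dim_col (P * R)"
    then have j: "j < k" using R by simp
    have "col R j = r j" using j r(1)[of j] by (intro eq_vecI) (auto simp: R_def)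
    moreover have "col X j = X *\<^sub>v unit_vec k j" using X j by (intro eq_vecI) auto
    ultimately show "col X j = col (P * R) j"
      using r(2)[of j] col_mult2[OF P R j] by simp
  qed (use X P R in auto)
  then show ?thesis using R by blast
qed

text \<open>The irreducible constituent is cut out by a matrix with the least positive number of columns
  among those whose image is an invariant subspace of the eigenspace.\<close>

lemma (in group) irreducible_constituent:
  assumes L: "representation G N L" and B: "B \<in> carrier_mat N N"
    and comm: "\<And>g. g \<in> carrier G \<Longrightarrow> L g * B = B * L g"
    and c: "eigenvalue B c"
  obtains m \<rho> P where "irreducible_representation G m \<rho>" "P \<in> carrier_mat N m" "injective_mat P"
    "B * P = c \<cdot>\<^sub>m P" "\<And>g. g \<in> carrier G \<Longrightarrow> L g * P = P * \<rho> g"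
proof -
  have Lc: "\<And>g. g \<in> carrier G \<Longrightarrow> L g \<in> carrier_mat N N"
    and L1: "L \<one> = 1\<^sub>m N"
    and Lm: "\<And>g h. g \<in> carrier G \<Longrightarrow> h \<in> carrier G \<Longrightarrow> L (g \<otimes> h) = L g * L h"
    using L by (auto simp: representation_iff)
  \<comment> \<open>The columns of \<open>P\<close> form a basis of an m-dimensional invariant
    subspace of the eigenspace, and \<open>R\<close> is the matrix of \<open>g\<close> in that
    basis.\<close>
  define Q where "Q m \<longleftrightarrow> m > 0 \<and> (\<exists>P. injective_mat P \<and> P \<in> carrier_mat N m \<and> B * P = c \<cdot>\<^sub>m P \<and>
    (\<forall>g\<in>carrier G. \<exists>R\<in>carrier_mat m m. L g * P = P * R))" for m
  have "\<exists>m. Q m"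
  proof -
    let ?W = "{v \<in> carrier_vec N. B *\<^sub>v v = c \<cdot>\<^sub>v v}"
    obtain m and P :: "complex mat" where P: "injective_mat P" "P \<in> carrier_mat N m"
      and W: "?W = (\<lambda>v. P *\<^sub>v v) ` carrier_vec m"
      using subspace_eq_image_injective_mat[OF eigenspace_subspace[OF B]] by metis
    obtain w where w: "w \<in> ?W" "w \<noteq> 0\<^sub>v N"
      using c B by (auto simp: eigenvalue_def eigenvector_def)
    have "m > 0"
    proof (rule ccontr)
      assume "\<not> m > 0"
      then have "P *\<^sub>v v = 0\<^sub>v N" if "v \<in> carrier_vec m" for v
        using P that by (intro eq_vecI) (auto simp: scalar_prod_def)
      then show False using w W by auto
    qed
    moreover have "B * P = c \<cdot>\<^sub>m P"
    proof (rule mat_eqI_mult_vec)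
      fix v :: "complex vec" assume v: "v \<in> carrier_vec m"
      then have "P *\<^sub>v v \<in> ?W" using W by blast
      then have "B *\<^sub>v (P *\<^sub>v v) = c \<cdot>\<^sub>v (P *\<^sub>v v)" by simp
      moreover have "(c \<cdot>\<^sub>m P) *\<^sub>v v = c \<cdot>\<^sub>v (P *\<^sub>v v)"
        using v P by (intro eq_vecI) auto
      ultimately show "B * P *\<^sub>v v = (c \<cdot>\<^sub>m P) *\<^sub>v v" using B P v by simp
    qed (use B P in auto)
    moreover have "\<exists>R\<in>carrier_mat m m. L g * P = P * R" if g: "g \<in> carrier G" for g
    proof (rule factor_through_mat)
      fix v :: "complex vec" assume v: "v \<in> carrier_vec m"
      then have "P *\<^sub>v v \<in> ?W" using W by blast
      then have "L g *\<^sub>v (P *\<^sub>v v) \<in> ?W"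
        using commute_imp_eigenspace_invariant[OF B Lc[OF g] comm[OF g]] Lc[OF g]
        by (auto intro!: mult_mat_vec_carrier[of _ N N])
      then show "L g * P *\<^sub>v v \<in> (\<lambda>w. P *\<^sub>v w) ` carrier_vec m"
        unfolding W using Lc[OF g] P v by simp
    qed (use Lc[OF g] P in auto)
    ultimately show ?thesis unfolding Q_def using P by blast
  qed
  define m where "m = (LEAST m. Q m)"
  have "Q m" unfolding m_def using \<open>\<exists>m. Q m\<close> by (rule LeastI_ex)
  have least: "m \<le> k" if "Q k" for k unfolding m_def using that by (rule Least_le)
  from \<open>Q m\<close> obtain P where m: "m > 0" and P: "injective_mat P" "P \<in> carrier_mat N m"
    and BP: "B * P = c \<cdot>\<^sub>m P" and "\<forall>g\<in>carrier G. \<exists>R\<in>carrier_mat m m. L g * P = P * R"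
    unfolding Q_def by blast
  \<comment> \<open>Because \<open>P\<close> can be cancelled on the left, these coefficient
    matrices are unique and therefore multiplicative.\<close>
  then obtain \<rho> where \<rho>: "g \<in> carrier G \<Longrightarrow> \<rho> g \<in> carrier_mat m m"
    "g \<in> carrier G \<Longrightarrow> L g * P = P * \<rho> g" for g
    by metis
  have "\<rho> \<one> = 1\<^sub>m m"
    by (rule injective_mat_cancel[OF P]) (use \<rho>[OF one_closed] L1 P in auto)
  moreover have "\<rho> (g \<otimes> h) = \<rho> g * \<rho> h" if gh: "g \<in> carrier G" "h \<in> carrier G" for g h
  proof (rule injective_mat_cancel[OF P])
    note gh' = Lc[OF gh(1)] Lc[OF gh(2)] \<rho>(1)[OF gh(1)] \<rho>(1)[OF gh(2)]
    have "P * \<rho> (g \<otimes> h) = L g * L h * P"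
      using \<rho>(2)[OF m_closed[OF gh]] Lm[OF gh] by simp
    also have "\<dots> = L g * (L h * P)" using gh'(1,2) P(2) by (rule assoc_mult_mat)
    also have "\<dots> = L g * (P * \<rho> h)" using \<rho>(2)[OF gh(2)] by simp
    also have "\<dots> = L g * P * \<rho> h" using gh'(1) P(2) gh'(4) by (rule assoc_mult_mat[symmetric])
    also have "\<dots> = P * \<rho> g * \<rho> h" using \<rho>(2)[OF gh(1)] by simp
    also have "\<dots> = P * (\<rho> g * \<rho> h)" using P(2) gh'(3,4) by (rule assoc_mult_mat)
    finally show "P * \<rho> (g \<otimes> h) = P * (\<rho> g * \<rho> h)" .
  qed (use gh \<rho>(1) in \<open>auto intro!: mult_carrier_mat[of _ m m]\<close>)
  ultimately have rep: "representation G m \<rho>" using \<rho>(1) by (simp add: representation_iff)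
  have "W = {0\<^sub>v m} \<or> W = carrier_vec m" if W: "invariant_subspace G m \<rho> W" for W
  proof -
    have sub: "VectorSpace.subspace class_ring W (module_vec TYPE(complex) m)"
      and inv: "\<And>g w. g \<in> carrier G \<Longrightarrow> w \<in> W \<Longrightarrow> \<rho> g *\<^sub>v w \<in> W"
      using W by (auto simp: invariant_subspace_def)
    obtain k and S :: "complex mat" where S: "injective_mat S" "S \<in> carrier_mat m k"
      and WS: "W = (\<lambda>v. S *\<^sub>v v) ` carrier_vec k"
      using subspace_eq_image_injective_mat[OF sub] by metis
    have "k \<le> m" using injective_mat_dim_le[OF S] .
    then consider "k = 0" | "k = m" | "0 < k" "k < m" by linarith
    then show ?thesis
    proof cases
      case 1
      then have "S *\<^sub>v v = 0\<^sub>v m" if "v \<in> carrier_vec k" for v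
        using S that by (intro eq_vecI) (auto simp: scalar_prod_def)
      then have "W \<subseteq> {0\<^sub>v m}" using WS by auto
      then show ?thesis using sub by (auto simp: subspace_iff)
    next
      case 2
      then show ?thesis using injective_mat_square_surj S WS by blast
    next
      \<comment> \<open>A proper nonzero invariant subspace with basis \<open>S\<close> yields the
        basis \<open>P * S\<close> of a smaller invariant subspace of the same eigenspace, against
        the minimality of \<open>m\<close>.\<close>
      case 3
      have PS: "P * S \<in> carrier_mat N k" using P S by simp
      have "B * (P * S) = c \<cdot>\<^sub>m (P * S)"
      proof -
        have "B * (P * S) = B * P * S" using B P(2) S(2) by (rule assoc_mult_mat[symmetric])
        also have "\<dots> = c \<cdot>\<^sub>m (P * S)"
          unfolding BP using P(2) S(2) by (rule mult_smult_assoc_mat)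
        finally show ?thesis .
      qed
      moreover have "\<exists>R\<in>carrier_mat k k. L g * (P * S) = P * S * R" if g: "g \<in> carrier G" for g
      proof -
        have "\<exists>R\<in>carrier_mat k k. \<rho> g * S = S * R"
        proof (rule factor_through_mat)
          fix v :: "complex vec" assume v: "v \<in> carrier_vec k"
          then have "\<rho> g *\<^sub>v (S *\<^sub>v v) \<in> W" using inv[OF g] WS by blast
          then show "\<rho> g * S *\<^sub>v v \<in> (\<lambda>w. S *\<^sub>v w) ` carrier_vec k"
            unfolding WS using \<rho>(1)[OF g] S v by simp
        qed (use \<rho>(1)[OF g] S in auto)
        then obtain R where R: "R \<in> carrier_mat k k" "\<rho> g * S = S * R" by blast
        have "L g * (P * S) = L g * P * S"
          using Lc[OF g] P(2) S(2) by (rule assoc_mult_mat[symmetric])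
        also have "\<dots> = P * (\<rho> g * S)"
          unfolding \<rho>(2)[OF g] using P(2) \<rho>(1)[OF g] S(2) by (rule assoc_mult_mat)
        also have "\<dots> = P * S * R"
          unfolding R(2) using P(2) S(2) R(1) by (rule assoc_mult_mat[symmetric])
        finally show ?thesis using R(1) by blast
      qed
      ultimately have "Q k"
        unfolding Q_def using 3 PS injective_mat_mult[OF P S] by blast
      then show ?thesis using least 3 by fastforce
    qed
  qed
  then have "irreducible_representation G m \<rho>"
    using rep m by (simp add: irreducible_representation_def)
  then show ?thesis using that P BP \<rho>(2) by blast
qed

section \<open>Convolution operators on the group and the regular representation\<close>

locale enumerated_finite_group = finite_group +
  fixes e :: "nat \<Rightarrow> 'a"
  assumes enum: "bij_betw e {..<Coset.order G} (carrier G)"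
begin

abbreviation N :: nat where "N \<equiv> Coset.order G"

text \<open>The matrix of convolution by \<open>f\<close> from the left in the basis of point
  masses. The product of such matrices is again convolution, and point masses give the left regular
  representation.\<close>

definition conv_mat :: "('a \<Rightarrow> complex) \<Rightarrow> complex mat" where
  "conv_mat f = mat N N (\<lambda>(i, j). f (e i \<otimes> inv (e j)))"

definition regular :: "'a \<Rightarrow> complex mat" where
  "regular h = conv_mat (\<lambda>x. if x = h then 1 else 0)"

lemma enum_carrier [simp]: "i < N \<Longrightarrow> e i \<in> carrier G"
  using enum by (auto simp: bij_betw_def)

lemma conv_mat_carrier [simp]: "conv_mat f \<in> carrier_mat N N"
  by (simp add: conv_mat_def)

lemma conv_mat_index: "i < N \<Longrightarrow> j < N \<Longrightarrow> conv_mat f $$ (i, j) = f (e i \<otimes> inv (e j))"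
  by (simp add: conv_mat_def)

lemma conv_mat_cong: "(\<And>x. x \<in> carrier G \<Longrightarrow> f x = f' x) \<Longrightarrow> conv_mat f = conv_mat f'"
  by (intro eq_matI) (auto simp: conv_mat_def)

lemma conv_mat_mult:
  "conv_mat f * conv_mat f' = conv_mat (\<lambda>x. \<Sum>z\<in>carrier G. f (x \<otimes> inv z) * f' z)"
proof (rule eq_matI)
  fix i j assume "i < dim_row (conv_mat (\<lambda>x. \<Sum>z\<in>carrier G. f (x \<otimes> inv z) * f' z))"
    "j < dim_col (conv_mat (\<lambda>x. \<Sum>z\<in>carrier G. f (x \<otimes> inv z) * f' z))"
  then have ij: "i < N" "j < N" by (simp_all add: conv_mat_def)
  have "(conv_mat f * conv_mat f') $$ (i, j) =
      (\<Sum>k<N. f (e i \<otimes> inv (e k)) * f' (e k \<otimes> inv (e j)))"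
    unfolding mat_mult_index_sum[OF conv_mat_carrier conv_mat_carrier ij]
    using ij by (simp add: conv_mat_index)
  also have "\<dots> = (\<Sum>y\<in>carrier G. f (e i \<otimes> inv y) * f' (y \<otimes> inv (e j)))"
    by (rule sum.reindex_bij_betw[OF enum])
  \<comment> \<open>The substitution y = z e(j) makes the sum depend on \<open>e i\<close> and
    \<open>e j\<close> only through the quotient \<open>e i \<otimes> inv (e j)\<close>.\<close>
  also have "\<dots> = (\<Sum>z\<in>carrier G. f (e i \<otimes> inv (z \<otimes> e j)) * f' (z \<otimes> e j \<otimes> inv (e j)))"
    using ij by (intro sum.reindex_bij_betw[symmetric] bij_betw_right_mult) simp
  also have "\<dots> = (\<Sum>z\<in>carrier G. f (e i \<otimes> inv (e j) \<otimes> inv z) * f' z)"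
    using ij by (intro sum.cong) (simp_all add: inv_mult_group m_assoc)
  finally show "(conv_mat f * conv_mat f') $$ (i, j) =
      conv_mat (\<lambda>x. \<Sum>z\<in>carrier G. f (x \<otimes> inv z) * f' z) $$ (i, j)"
    using ij by (simp add: conv_mat_index)
qed (simp_all add: conv_mat_def)

lemma regular_mult_conv_mat:
  assumes h: "h \<in> carrier G"
  shows "regular h * conv_mat f = conv_mat (\<lambda>x. f (inv h \<otimes> x))"
  unfolding regular_def conv_mat_mult
proof (rule conv_mat_cong)
  fix x assume x: "x \<in> carrier G"
  have "x \<otimes> inv z = h \<longleftrightarrow> z = inv h \<otimes> x" if z: "z \<in> carrier G" for z
    using x h z by (metis inv_closed inv_solve_left inv_solve_right)
  then have "(\<Sum>z\<in>carrier G. (if x \<otimes> inv z = h then 1 else 0) * f z) =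
      (\<Sum>z\<in>carrier G. if z = inv h \<otimes> x then f (inv h \<otimes> x) else 0)"
    by (intro sum.cong) auto
  then show "(\<Sum>z\<in>carrier G. (if x \<otimes> inv z = h then 1 else 0) * f z) = f (inv h \<otimes> x)"
    using x h finite_carrier by simp
qed

lemma conv_mat_mult_regular:
  assumes h: "h \<in> carrier G"
  shows "conv_mat f * regular h = conv_mat (\<lambda>x. f (x \<otimes> inv h))"
  unfolding regular_def conv_mat_mult
proof (rule conv_mat_cong)
  fix x assume x: "x \<in> carrier G"
  have "(\<Sum>z\<in>carrier G. f (x \<otimes> inv z) * (if z = h then 1 else 0)) =
      (\<Sum>z\<in>carrier G. if z = h then f (x \<otimes> inv h) else 0)"
    by (intro sum.cong) auto
  then show "(\<Sum>z\<in>carrier G. f (x \<otimes> inv z) * (if z = h then 1 else 0)) = f (x \<otimes> inv h)"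
    using h finite_carrier by simp
qed

lemma regular_carrier [simp]: "regular h \<in> carrier_mat N N"
  by (simp add: regular_def)

text \<open>Translating on the left or on the right gives the same function, because a class
  function does not see the order of two factors.\<close>

lemma regular_commute:
  assumes f: "class_function G f" and h: "h \<in> carrier G"
  shows "regular h * conv_mat f = conv_mat f * regular h"
  unfolding regular_mult_conv_mat[OF h] conv_mat_mult_regular[OF h]
  using class_function_commute[OF f] h by (intro conv_mat_cong) simp

lemma regular_representation: "representation G N regular"
proof -
  have "regular \<one> = 1\<^sub>m N"
  proof (rule eq_matI)
    fix i j assume ij: "i < dim_row (1\<^sub>m N)" "j < dim_col (1\<^sub>m N)"
    have "e i \<otimes> inv (e j) = \<one> \<longleftrightarrow> e i = e j"
      using ij by (metis enum_carrier index_one_mat(2,3) inv_closed inv_equality inv_inv r_inv)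
    also have "\<dots> \<longleftrightarrow> i = j"
      using enum ij by (auto simp: bij_betw_def inj_on_def)
    finally show "regular \<one> $$ (i, j) = 1\<^sub>m N $$ (i, j)"
      using ij by (simp add: regular_def conv_mat_index)
  qed (simp_all add: regular_def conv_mat_def)
  moreover have "regular (x \<otimes> y) = regular x * regular y" if "x \<in> carrier G" "y \<in> carrier G" for x y
    unfolding regular_def[of y] regular_mult_conv_mat[OF that(1)]
    unfolding regular_def
    using that by (intro conv_mat_cong) (metis inv_solve_left')
  ultimately show ?thesis by (simp add: representation_iff)
qed

text \<open>Exhibits \<open>conv_mat f\<close> as the operator of \<open>f\<close> in the regular
  representation, so that it can be transported to a constituent term by term.\<close>

lemma conv_mat_eq_sum: "conv_mat f = mat_sum N N (carrier G) (\<lambda>x. f x \<cdot>\<^sub>m regular x)"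
proof (rule eq_matI)
  fix i j assume "i < dim_row (mat_sum N N (carrier G) (\<lambda>x. f x \<cdot>\<^sub>m regular x))"
    "j < dim_col (mat_sum N N (carrier G) (\<lambda>x. f x \<cdot>\<^sub>m regular x))"
  then have ij: "i < N" "j < N" by (simp_all add: mat_sum_def)
  let ?y = "e i \<otimes> inv (e j)"
  have "mat_sum N N (carrier G) (\<lambda>x. f x \<cdot>\<^sub>m regular x) $$ (i, j) =
      (\<Sum>x\<in>carrier G. if x = ?y then f ?y else 0)"
    using ij unfolding mat_sum_index[OF ij]
    by (intro sum.cong) (auto simp: regular_def conv_mat_def)
  then show "conv_mat f $$ (i, j) = mat_sum N N (carrier G) (\<lambda>x. f x \<cdot>\<^sub>m regular x) $$ (i, j)"
    using ij finite_carrier by (simp add: conv_mat_index)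
qed (simp_all add: mat_sum_def conv_mat_def)

text \<open>If \<open>f\<close> were nonzero, the adjoint of its convolution operator times the
  operator itself would have positive trace and thus a nonzero eigenvalue \<open>c\<close>. In an
  irreducible constituent of that eigenspace \<open>f\<close> acts as zero by \<open>kill\<close>,
  while the product acts as \<open>c\<close>.\<close>

lemma class_function_detected:
  assumes f: "class_function G f"
    and kill: "\<And>n \<rho>. irreducible_representation G n \<rho> \<Longrightarrow> rep_sum G n \<rho> f = 0\<^sub>m n n"
    and x: "x \<in> carrier G"
  shows "f x = 0"
proof (rule ccontr)
  assume "f x \<noteq> 0"
  \<comment> \<open>The involution of the group algebra: \<open>conv_mat f'\<close> is the conjugate
    transpose of \<open>conv_mat f\<close>.\<close>
  define f' where "f' y = cnj (f (inv y))" for y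
  have f': "class_function G f'"
    unfolding class_function_def f'_def
  proof (intro ballI)
    fix y h assume "y \<in> carrier G" "h \<in> carrier G"
    moreover from this have "inv (h \<otimes> y \<otimes> inv h) = h \<otimes> inv y \<otimes> inv h"
      by (simp add: inv_mult_group m_assoc)
    ultimately show "cnj (f (inv (h \<otimes> y \<otimes> inv h))) = cnj (f (inv y))"
      using f by (simp add: class_function_def)
  qed
  define B where "B = conv_mat f' * conv_mat f"
  have B: "B \<in> carrier_mat N N"
    by (simp add: B_def mult_carrier_mat[of _ N N])
  have comm: "regular h * B = B * regular h" if h: "h \<in> carrier G" for h
  proof -
    have "regular h * B = regular h * conv_mat f' * conv_mat f"
      unfolding B_def by (rule assoc_mult_mat[of _ N N _ N _ N, symmetric]) simp_all
    also have "\<dots> = conv_mat f' * (regular h * conv_mat f)"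
      unfolding regular_commute[OF f' h] by (rule assoc_mult_mat[of _ N N _ N _ N]) simp_all
    also have "\<dots> = B * regular h"
      unfolding B_def regular_commute[OF f h]
      by (rule assoc_mult_mat[of _ N N _ N _ N, symmetric]) simp_all
    finally show ?thesis .
  qed
  have "mat_trace B = (\<Sum>i<N. \<Sum>z\<in>carrier G. f' (\<one> \<otimes> inv z) * f z)"
    unfolding mat_trace_carrier[OF B]
    by (rule sum.cong) (simp_all add: B_def conv_mat_mult conv_mat_index)
  also have "(\<Sum>z\<in>carrier G. f' (\<one> \<otimes> inv z) * f z) = of_real (\<Sum>z\<in>carrier G. (cmod (f z))\<^sup>2)"
    unfolding of_real_sum
    by (rule sum.cong) (simp_all add: f'_def mult.commute complex_norm_square[symmetric])
  finally have trace: "mat_trace B = of_nat N * of_real (\<Sum>z\<in>carrier G. (cmod (f z))\<^sup>2)" by simp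
  have "(\<Sum>z\<in>carrier G. (cmod (f z))\<^sup>2) \<noteq> 0"
    using x \<open>f x \<noteq> 0\<close> finite_carrier by (subst sum_nonneg_eq_0_iff) auto
  then have "mat_trace B \<noteq> 0"
    unfolding trace using order_pos by (metis mult_eq_0_iff of_nat_eq_0_iff of_real_eq_0_iff less_irrefl)
  then obtain c where c: "c \<noteq> 0" "eigenvalue B c"
    using mat_trace_nonzero_eigenvalue[OF B] by blast
  obtain m \<rho> P where \<rho>: "irreducible_representation G m \<rho>" and P: "P \<in> carrier_mat N m" "injective_mat P"
    and BP: "B * P = c \<cdot>\<^sub>m P" and LP: "\<And>g. g \<in> carrier G \<Longrightarrow> regular g * P = P * \<rho> g"
    using irreducible_constituent[OF regular_representation B comm c(2)] by blast
  interpret finite_group_irrep G m \<rho> by unfold_locales (rule \<rho>)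
  \<comment> \<open>The intertwining relation \<open>LP\<close> carries the operator of
    \<open>f\<close> through \<open>P\<close>, where it becomes \<open>rep_sum G m \<rho> f\<close>
    and hence zero.\<close>
  have "conv_mat f * P = mat_sum N m (carrier G) (\<lambda>x. f x \<cdot>\<^sub>m regular x * P)"
    unfolding conv_mat_eq_sum using P(1) by (intro mat_sum_mult_mat) simp_all
  also have "\<dots> = mat_sum N m (carrier G) (\<lambda>x. P * (f x \<cdot>\<^sub>m \<rho> x))"
  proof (rule mat_sum_cong)
    fix x assume x: "x \<in> carrier G"
    show "f x \<cdot>\<^sub>m regular x * P = P * (f x \<cdot>\<^sub>m \<rho> x)"
      using mult_smult_assoc_mat[of "regular x" N N P m "f x"] P(1) LP[OF x]
        mult_smult_distrib[OF P(1) rep_carrier[OF x], of "f x"] by simp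
  qed
  also have "\<dots> = P * rep_sum G m \<rho> f"
    unfolding rep_sum_def using P(1) by (intro mat_mult_mat_sum[symmetric]) simp_all
  also have "\<dots> = 0\<^sub>m N m" using kill[OF \<rho>] P(1) by simp
  finally have "conv_mat f * P = 0\<^sub>m N m" .
  moreover have "B * P = conv_mat f' * (conv_mat f * P)"
    unfolding B_def using P(1) by (intro assoc_mult_mat[of _ N N _ N _ m]) simp_all
  ultimately have "c \<cdot>\<^sub>m P = 0\<^sub>m N m" using BP by (simp add: right_mult_zero_mat[of _ N N])
  then have "c * P $$ (i, j) = 0" if "i < N" "j < m" for i j
    using that P(1) by (metis carrier_matD index_smult_mat(1) index_zero_mat(1))
  then have "P = 0\<^sub>m N m" using c(1) P(1) by (intro eq_matI) auto
  \<comment> \<open>Since \<open>m > 0\<close>, a zero matrix with \<open>m\<close> columns kills a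
    unit vector and cannot be injective.\<close>
  then have "P *\<^sub>v unit_vec m 0 = 0\<^sub>v N" by (intro eq_vecI) auto
  then have "unit_vec m 0 = (0\<^sub>v m :: complex vec)"
    by (intro injective_matD[OF P(2,1)]) auto
  then show False using degree_pos by (metis index_unit_vec(1) index_zero_vec(1) zero_neq_one)
qed

end

lemma (in finite_group) class_function_eq_zero:
  assumes "class_function G f"
    and "\<And>n \<rho>. irreducible_representation G n \<rho> \<Longrightarrow> rep_sum G n \<rho> f = 0\<^sub>m n n"
    and "x \<in> carrier G"
  shows "f x = 0"
proof -
  obtain e where "bij_betw e {0..<Coset.order G} (carrier G)"
    using ex_bij_betw_nat_finite[OF finite_carrier] by (auto simp: Coset.order_def)
  then interpret enumerated_finite_group G e
    by unfold_locales (simp add: atLeast0LessThan)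
  show ?thesis using assms by (rule class_function_detected)
qed

subsection \<open>Commutator cosets\<close>

context group
begin

lemma commutator_closed [simp]:
  "g \<in> carrier G \<Longrightarrow> x \<in> carrier G \<Longrightarrow> commutator G g x \<in> carrier G"
  by (simp add: commutator_def)

lemma mult_commutator:
  "g \<in> carrier G \<Longrightarrow> x \<in> carrier G \<Longrightarrow> g \<otimes> commutator G g x = inv x \<otimes> g \<otimes> x"
  by (simp add: commutator_def flip: m_assoc)

lemma subgroup_commutator_subgroup:
  "g \<in> carrier G \<Longrightarrow> subgroup (commutator_subgroup G g) G"
  unfolding commutator_subgroup_def by (rule generate_is_subgroup) auto

lemma commutator_in_commutator_subgroup:
  "x \<in> carrier G \<Longrightarrow> commutator G g x \<in> commutator_subgroup G g"
  unfolding commutator_subgroup_def by (rule generate.incl) auto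

text \<open>Conjugates of generators stay inside because of \<open>[g,x]\<^sup>y = [g,y]\<^sup>-\<^sup>1 [g,xy]\<close>.\<close>

lemma commutator_subgroup_conj_closed:
  assumes g: "g \<in> carrier G" and h: "h \<in> carrier G" and n: "n \<in> commutator_subgroup G g"
  shows "h \<otimes> n \<otimes> inv h \<in> commutator_subgroup G g"
proof -
  let ?N = "commutator_subgroup G g"
  interpret N: subgroup ?N G by (rule subgroup_commutator_subgroup[OF g])
  have gen: "h \<otimes> commutator G g x \<otimes> inv h \<in> ?N" if x: "x \<in> carrier G" for x
  proof -
    have "h \<otimes> commutator G g x \<otimes> inv h = inv (commutator G g (inv h)) \<otimes> commutator G g (x \<otimes> inv h)"
    proof -
      have c: "a \<otimes> (inv a \<otimes> b) = b" "inv a \<otimes> (a \<otimes> b) = b" if "a \<in> carrier G" "b \<in> carrier G" for a b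
        using that by (simp_all flip: m_assoc)
      show ?thesis using g h x by (simp add: commutator_def inv_mult_group m_assoc c)
    qed
    then show ?thesis
      using commutator_in_commutator_subgroup[of _ g] h x by simp
  qed
  have "n \<in> generate G {commutator G g x | x. x \<in> carrier G}"
    using n by (simp add: commutator_subgroup_def)
  then show ?thesis
  proof (induction n rule: generate.induct)
    case one
    then show ?case using h by simp
  next
    case (incl c)
    then show ?case using gen by auto
  next
    case (inv c)
    then obtain x where x: "x \<in> carrier G" "c = commutator G g x" by auto
    then have "h \<otimes> inv c \<otimes> inv h = inv (h \<otimes> c \<otimes> inv h)"
      using g h by (simp add: inv_mult_group m_assoc)
    then show ?case using gen[OF x(1)] x by simp
  next
    case (eng a b)
    then have "a \<in> carrier G" "b \<in> carrier G"
      using N.subset by (auto simp: commutator_subgroup_def)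
    then have "h \<otimes> (a \<otimes> b) \<otimes> inv h = (h \<otimes> a \<otimes> inv h) \<otimes> (h \<otimes> b \<otimes> inv h)"
      using h by (simp add: m_assoc) (simp flip: m_assoc)
    then show ?case using eng by simp
  qed
qed

definition commutator_coset :: "'a \<Rightarrow> 'a set" where
  "commutator_coset g = (\<lambda>n. g \<otimes> n) ` commutator_subgroup G g"

text \<open>A conjugate of \<open>g\<close> by \<open>x\<close> is g [g,x].\<close>

lemma conj_class_subset_commutator_coset:
  assumes g: "g \<in> carrier G"
  shows "conj_class G g \<subseteq> commutator_coset g"
proof
  fix y assume "y \<in> conj_class G g"
  then obtain x where "x \<in> carrier G" "y = g \<otimes> commutator G g x"
    using mult_commutator[OF g] by (auto simp: conj_class_def)
  then show "y \<in> commutator_coset g"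
    using commutator_in_commutator_subgroup unfolding commutator_coset_def by blast
qed

lemma commutator_coset_subset: "g \<in> carrier G \<Longrightarrow> commutator_coset g \<subseteq> carrier G"
  using subgroup.subset[OF subgroup_commutator_subgroup] by (auto simp: commutator_coset_def)

lemma card_commutator_coset:
  assumes "g \<in> carrier G"
  shows "card (commutator_coset g) = card (commutator_subgroup G g)"
  unfolding commutator_coset_def
  by (intro card_image inj_onI)
    (use assms subgroup.mem_carrier[OF subgroup_commutator_subgroup[OF assms]] in simp)

text \<open>Conjugating g n by h gives g [g,h^-1] (h n h^-1), and the last factor stays in [g,G] by
  normality.\<close>

lemma commutator_coset_conj_closed:
  assumes g: "g \<in> carrier G" and h: "h \<in> carrier G" and x: "x \<in> commutator_coset g"
  shows "h \<otimes> x \<otimes> inv h \<in> commutator_coset g"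
proof -
  obtain n where n: "n \<in> commutator_subgroup G g" "x = g \<otimes> n"
    using x by (auto simp: commutator_coset_def)
  then have nc: "n \<in> carrier G"
    using subgroup.subset[OF subgroup_commutator_subgroup[OF g]] by auto
  have "h \<otimes> x \<otimes> inv h = (h \<otimes> g \<otimes> inv h) \<otimes> (h \<otimes> n \<otimes> inv h)"
    using g h nc n(2) by (simp add: m_assoc) (simp flip: m_assoc)
  also have "h \<otimes> g \<otimes> inv h = g \<otimes> commutator G g (inv h)"
    using mult_commutator[OF g, of "inv h"] h by simp
  finally have "h \<otimes> x \<otimes> inv h = g \<otimes> (commutator G g (inv h) \<otimes> (h \<otimes> n \<otimes> inv h))"
    using g h nc by (simp add: m_assoc)
  moreover have "commutator G g (inv h) \<otimes> (h \<otimes> n \<otimes> inv h) \<in> commutator_subgroup G g"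
    using commutator_in_commutator_subgroup[OF inv_closed[OF h]] commutator_subgroup_conj_closed[OF g h n(1)]
    by (rule subgroup.m_closed[OF subgroup_commutator_subgroup[OF g]])
  ultimately show ?thesis unfolding commutator_coset_def by blast
qed

lemma conj_class_conj_closed:
  assumes g: "g \<in> carrier G" and h: "h \<in> carrier G" and x: "x \<in> conj_class G g"
  shows "h \<otimes> x \<otimes> inv h \<in> conj_class G g"
proof -
  obtain y where y: "y \<in> carrier G" "x = inv y \<otimes> g \<otimes> y"
    using x by (auto simp: conj_class_def)
  then have "h \<otimes> x \<otimes> inv h = inv (y \<otimes> inv h) \<otimes> g \<otimes> (y \<otimes> inv h)"
    using g h by (simp add: inv_mult_group m_assoc)
  then show ?thesis using y h unfolding conj_class_def by blast
qed

lemma class_function_of_bool: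
  assumes S: "S \<subseteq> carrier G" and closed: "\<And>h x. h \<in> carrier G \<Longrightarrow> x \<in> S \<Longrightarrow> h \<otimes> x \<otimes> inv h \<in> S"
  shows "class_function G (\<lambda>x. of_bool (x \<in> S))"
proof -
  have "x \<in> S" if "x \<in> carrier G" "h \<in> carrier G" "h \<otimes> x \<otimes> inv h \<in> S" for x h
  proof -
    have "inv h \<otimes> (h \<otimes> x \<otimes> inv h) \<otimes> inv (inv h) = x"
      using that(1,2) by (simp add: m_assoc) (simp flip: m_assoc)
    then show ?thesis using closed[OF inv_closed[OF that(2)] that(3)] by simp
  qed
  then have "h \<otimes> x \<otimes> inv h \<in> S \<longleftrightarrow> x \<in> S" if "x \<in> carrier G" "h \<in> carrier G" for x h
    using that closed by blast
  then show ?thesis by (simp add: class_function_def)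
qed

end

section \<open>Sums of an irreducible character over conjugacy classes and commutator cosets\<close>

context finite_group_irrep
begin

lemma character_conj:
  assumes "g \<in> carrier G" "y \<in> carrier G"
  shows "mat_trace (\<rho> (inv y \<otimes> g \<otimes> y)) = mat_trace (\<rho> g)"
proof -
  have "mat_trace (\<rho> (inv y \<otimes> g) * \<rho> y) = mat_trace (\<rho> y * \<rho> (inv y \<otimes> g))"
    using assms by (intro mat_trace_mult_commute[of _ n n]) auto
  then show ?thesis using assms by (simp flip: rep_mult m_assoc)
qed

lemma sum_character_conj_class:
  assumes "g \<in> carrier G"
  shows "(\<Sum>x\<in>conj_class G g. mat_trace (\<rho> x)) = of_nat (card (conj_class G g)) * mat_trace (\<rho> g)"
proof -
  have "(\<Sum>x\<in>conj_class G g. mat_trace (\<rho> x)) = (\<Sum>x\<in>conj_class G g. mat_trace (\<rho> g))"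
    by (rule sum.cong) (auto simp: conj_class_def character_conj[OF assms])
  then show ?thesis by simp
qed

lemma commutator_subgroup_in_kernel:
  assumes g: "g \<in> scalar_elements G n \<rho>" and h: "h \<in> commutator_subgroup G g"
  shows "\<rho> h = 1\<^sub>m n"
proof -
  have gc: "g \<in> carrier G" using g by (simp add: scalar_elements_def)
  have com: "\<rho> (commutator G g x) = 1\<^sub>m n" if "x \<in> carrier G" for x
    using scalar_elements_iff_commutator[OF gc] g that by blast
  have "h \<in> generate G {commutator G g x | x. x \<in> carrier G}"
    using h by (simp add: commutator_subgroup_def)
  then show ?thesis
  proof (induction h rule: generate.induct)
    case (incl c)
    then show ?case using com by auto
  next
    case (inv c)
    then obtain x where x: "x \<in> carrier G" "c = commutator G g x" by auto
    then have "c \<in> carrier G" using gc by simp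
    then have "\<rho> c * \<rho> (inv c) = 1\<^sub>m n" by simp
    then show ?case using x com \<open>c \<in> carrier G\<close> left_mult_one_mat[of "\<rho> (inv c)" n n] by simp
  next
    case (eng a b)
    then have "a \<in> carrier G" "b \<in> carrier G"
      using subgroup.subset[OF subgroup_commutator_subgroup[OF gc]]
      by (auto simp: commutator_subgroup_def)
    then show ?case using eng by (simp add: rep_mult)
  qed simp
qed

text \<open>Here [g,G] acts trivially, so \<open>\<rho>\<close> is constant on the coset.\<close>

lemma sum_character_commutator_coset_scalar:
  assumes g: "g \<in> scalar_elements G n \<rho>"
  shows "(\<Sum>x\<in>commutator_coset g. mat_trace (\<rho> x)) =
    of_nat (card (commutator_subgroup G g)) * mat_trace (\<rho> g)"
proof -
  have gc: "g \<in> carrier G" using g by (simp add: scalar_elements_def)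
  have "\<rho> (g \<otimes> h) = \<rho> g" if h: "h \<in> commutator_subgroup G g" for h
  proof -
    have "h \<in> carrier G"
      using subgroup.subset[OF subgroup_commutator_subgroup[OF gc]] h by auto
    then show ?thesis
      using commutator_subgroup_in_kernel[OF g h] gc right_mult_one_mat[of "\<rho> g" n n]
      by (simp add: rep_mult)
  qed
  then have "(\<Sum>x\<in>commutator_coset g. mat_trace (\<rho> x)) = (\<Sum>x\<in>commutator_coset g. mat_trace (\<rho> g))"
    by (intro sum.cong) (auto simp: commutator_coset_def)
  then show ?thesis by (simp add: card_commutator_coset[OF gc])
qed

text \<open>With a nonzero sum, the coset would act as a nonzero scalar that absorbs right
  multiplication by [g,G]. Then [g,G] would act trivially, which makes \<open>g\<close>
  scalar.\<close>

lemma sum_character_commutator_coset_nonscalar: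
  assumes g: "g \<in> carrier G" "g \<notin> scalar_elements G n \<rho>"
  shows "(\<Sum>x\<in>commutator_coset g. mat_trace (\<rho> x)) = 0"
proof (rule ccontr)
  assume nz: "\<not> ?thesis"
  let ?C = "commutator_coset g"
  interpret N: subgroup "commutator_subgroup G g" G
    by (rule subgroup_commutator_subgroup[OF g(1)])
  have f: "class_function G (\<lambda>x. of_bool (x \<in> ?C))"
    using commutator_coset_subset[OF g(1)] commutator_coset_conj_closed[OF g(1)]
    by (rule class_function_of_bool)
  have sum: "(\<Sum>x\<in>carrier G. of_bool (x \<in> ?C) * mat_trace (\<rho> x)) = (\<Sum>x\<in>?C. mat_trace (\<rho> x))"
    using finite_carrier commutator_coset_subset[OF g(1)]
    by (simp add: sum_of_bool_mult_eq Int_absorb1)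
  have closed: "x \<otimes> h \<in> ?C" if "x \<in> ?C" "h \<in> commutator_subgroup G g" for x h
    using that g(1) by (auto simp: commutator_coset_def m_assoc)
  have "\<rho> h = 1\<^sub>m n" if h: "h \<in> commutator_subgroup G g" for h
  proof (rule class_function_right_invariant_kernel[OF f])
    fix x assume x: "x \<in> carrier G"
    have "x \<in> ?C" if "x \<otimes> h \<in> ?C"
      using closed[OF that, of "inv h"] h x by (simp add: m_assoc)
    then show "of_bool (x \<otimes> h \<in> ?C) = (of_bool (x \<in> ?C) :: complex)"
      using closed h by auto
  qed (use h nz sum in auto)
  then have "g \<in> scalar_elements G n \<rho>"
    unfolding scalar_elements_iff_commutator[OF g(1)]
    using commutator_in_commutator_subgroup by blast
  then show False using g(2) by simp
qed

end

section \<open>The two conditions restated, and both implications\<close>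

context finite_group
begin

lemma finite_conj_class: "g \<in> carrier G \<Longrightarrow> finite (conj_class G g)"
  by (rule finite_subset[OF subset_trans[OF conj_class_subset_commutator_coset commutator_coset_subset]
      finite_carrier])

lemma card_conj_class_pos:
  assumes "g \<in> carrier G"
  shows "card (conj_class G g) > 0"
proof -
  have "inv \<one> \<otimes> g \<otimes> \<one> \<in> conj_class G g" unfolding conj_class_def by blast
  then show ?thesis using finite_conj_class[OF assms] by (auto simp: card_gt_0_iff)
qed

text \<open>The class lies in the coset, and the coset has the size of [g,G]; for finite sets equal
  size then means equality.\<close>

lemma flat_group_iff:
  "flat_group G \<longleftrightarrow> (\<forall>g\<in>carrier G. conj_class G g = commutator_coset g)"
proof -
  have "card (conj_class G g) = card (commutator_subgroup G g) \<longleftrightarrow> conj_class G g = commutator_coset g"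
    if g: "g \<in> carrier G" for g
    using card_subset_eq[OF _ conj_class_subset_commutator_coset[OF g]]
      finite_subset[OF commutator_coset_subset[OF g] finite_carrier] card_commutator_coset[OF g]
    by metis
  then show ?thesis by (simp add: flat_group_def)
qed

lemma GVZ_group_iff:
  "GVZ_group G \<longleftrightarrow> (\<forall>n \<rho>. irreducible_representation G n \<rho> \<longrightarrow>
    (\<forall>g\<in>carrier G - scalar_elements G n \<rho>. mat_trace (\<rho> g) = 0))"
proof -
  have "finite_group_irrep G n \<rho>" if "irreducible_representation G n \<rho>" for n \<rho>
    using that by unfold_locales
  then show ?thesis
    unfolding GVZ_group_def Irr_def using finite_group_irrep.degree_eq_sqrt_index_iff
    by blast
qed

lemma flat_imp_GVZ:
  assumes "flat_group G"
  shows "GVZ_group G"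
  unfolding GVZ_group_iff
proof (intro allI impI ballI)
  fix n \<rho> g
  assume \<rho>: "irreducible_representation G n \<rho>" and g: "g \<in> carrier G - scalar_elements G n \<rho>"
  interpret finite_group_irrep G n \<rho> by unfold_locales (rule \<rho>)
  have "conj_class G g = commutator_coset g" using assms g by (simp add: flat_group_iff)
  \<comment> \<open>The vanishing coset sum is now the class sum, that is, the positive class size
    times the value at \<open>g\<close>.\<close>
  then show "mat_trace (\<rho> g) = 0"
    using sum_character_commutator_coset_nonscalar[of g] sum_character_conj_class[of g]
      card_conj_class_pos[of g] g by simp
qed

lemma GVZ_imp_flat:
  assumes "GVZ_group G"
  shows "flat_group G"
  unfolding flat_group_iff
proof
  fix g assume g: "g \<in> carrier G"
  let ?K = "conj_class G g" and ?C = "commutator_coset g" and ?N = "commutator_subgroup G g"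
  have C: "?C \<subseteq> carrier G" by (rule commutator_coset_subset[OF g])
  have KC: "?K \<subseteq> ?C" by (rule conj_class_subset_commutator_coset[OF g])
  \<comment> \<open>The difference of the indicators of class and coset, each divided by its size,
    after clearing denominators; the coset has the size of \<open>?N\<close>.\<close>
  define f :: "'a \<Rightarrow> complex" where
    "f x = of_nat (card ?N) * of_bool (x \<in> ?K) - of_nat (card ?K) * of_bool (x \<in> ?C)" for x
  have "class_function G (\<lambda>x. of_bool (x \<in> ?K))" "class_function G (\<lambda>x. of_bool (x \<in> ?C))"
    using class_function_of_bool[OF C commutator_coset_conj_closed[OF g]]
      class_function_of_bool[of ?K, OF _ conj_class_conj_closed[OF g]] C KC
    by auto
  then have f: "class_function G f"
    unfolding class_function_def f_def by simp
  have "rep_sum G n \<rho> f = 0\<^sub>m n n" if \<rho>: "irreducible_representation G n \<rho>" for n \<rho>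
  proof -
    interpret finite_group_irrep G n \<rho> by unfold_locales (rule \<rho>)
    have "(\<Sum>x\<in>carrier G. f x * mat_trace (\<rho> x)) =
        of_nat (card ?N) * (\<Sum>x\<in>carrier G. of_bool (x \<in> ?K) * mat_trace (\<rho> x)) -
        of_nat (card ?K) * (\<Sum>x\<in>carrier G. of_bool (x \<in> ?C) * mat_trace (\<rho> x))"
      by (simp add: f_def algebra_simps sum_subtractf sum_distrib_left)
    also have "\<dots> = of_nat (card ?N) * (\<Sum>x\<in>?K. mat_trace (\<rho> x)) -
        of_nat (card ?K) * (\<Sum>x\<in>?C. mat_trace (\<rho> x))"
      using finite_carrier C KC by (simp add: sum_of_bool_mult_eq Int_absorb1 subset_trans[OF KC C])
    \<comment> \<open>For scalar \<open>g\<close> both terms equal the product of the two sizes and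
      the value at \<open>g\<close>. Otherwise the class sum vanishes by the GVZ condition and the
      coset sum vanishes in any case.\<close>
    also have "\<dots> = 0"
    proof (cases "g \<in> scalar_elements G n \<rho>")
      case True
      then show ?thesis
        by (simp add: sum_character_conj_class[OF g] sum_character_commutator_coset_scalar)
    next
      case False
      then have "mat_trace (\<rho> g) = 0" using assms \<rho> g by (simp add: GVZ_group_iff)
      then show ?thesis
        using False by (simp add: sum_character_conj_class[OF g] sum_character_commutator_coset_nonscalar[OF g])
    qed
    finally have 0: "(\<Sum>x\<in>carrier G. f x * mat_trace (\<rho> x)) = 0" .
    obtain c where "rep_sum G n \<rho> f = c \<cdot>\<^sub>m 1\<^sub>m n" "of_nat n * c = 0"
      using rep_sum_scalar[OF f] 0 by metis
    then show ?thesis using scalar_mat_eq_zero[of c n] by (simp add: mat_trace_smult_one)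
  qed
  then have f0: "f x = 0" if "x \<in> carrier G" for x
    using class_function_eq_zero[OF f] that by blast
  \<comment> \<open>At a point of the coset outside the class \<open>f\<close> would be minus the
    class size, which is nonzero.\<close>
  have "?C \<subseteq> ?K"
  proof
    fix x assume x: "x \<in> ?C"
    then have "f x = 0" using f0 C by auto
    then show "x \<in> ?K"
      using x card_conj_class_pos[OF g] by (cases "x \<in> ?K") (auto simp: f_def)
  qed
  then show "?K = ?C" using KC by blast
qed

end

theorem theorem1:
  fixes G :: "('a, 'b) monoid_scheme"
  assumes "group G" and "finite (carrier G)"
  shows "flat_group G \<longleftrightarrow> GVZ_group G"
proof -
  interpret finite_group G
    using assms by (simp add: finite_group_def finite_group_axioms_def)
  show ?thesis using flat_imp_GVZ GVZ_imp_flat by blast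
qed

end
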